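(* For any nonempty symmetric set $S\subseteq\{0,1\}^n$ and $t\ge1$, we have \[ \mathrm{EHC}_n^{(t,t-1)}(\{0,1\}^n\setminus S)=\mathrm{EPC}_n^{(t,t-1)}(\{0,1\}^n\setminus S)=\overline{\Lambda}_n(S)+2t-2. \]
   Context: Work over $\mathbb R$ with $\mathbb R[X_1,\dots,X_n]$. A polynomial $P$ has multiplicity at least $t$ at $a\in\mathbb R^n$ if all partial derivatives of $P$ of order less than $t$ vanish at $a$; $\mathrm{mult}(P,a)$ is the largest such $t$. For $T\subsetneq\{0,1\}^n$, $t\ge1$, $\ell\in[0,t-1]$: a $(t,\ell)$-exact hyperplane cover of $T$ is a finite multiset of affine hyperplanes in $\mathbb R^n$ such that every point of $T$ lies in at least $t$ of them and every point of $\{0,1\}^n\setminus T$ lies in exactly $\ell$ of them (counted with multiplicity); a $(t,\ell)$-exact polynomial cover of $T$ is a nonzero polynomial $P$ with $\mathrm{mult}(P,a)\ge t$ for all $a\in T$ and $\mathrm{mult}(P,b)=\ell$ for all $b\in\{0,1\}^n\setminus T$. $\mathrm{EHC}_n^{(t,\ell)}(T)$ is the minimum size of a $(t,\ell)$-exact hyperplane cover of $T$ and $\mathrm{EPC}_n^{(t,\ell)}(T)$ the minimum degree of a $(t,\ell)$-exact polynomial cover of $T$. A set $S\subseteq\{0,1\}^n$ is symmetric if closed under permutations of coordinates; $W_n(S)=\{|x|:x\in S\}$ where $|x|$ is the Hamming weight. For $i\in[0,n]$, $W_{n,i}=[0,i-1]\cup[n-i+1,n]$ (integer intervals). $\mu_n(S)=\max\{i\in[0,\lceil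 n/2\rceil]:W_{n,i}\subseteq W_n(S)\}$, $\Lambda_n(S)=|W_n(S)|-\mu_n(S)$, $\overline{\Lambda}_n(S)=\Lambda_n(\{0,1\}^n\setminus S)$. *)

theory Defs
  imports "HOL-Analysis.Analysis" "HOL-Library.Poly_Mapping" "HOL-Library.Extended_Nat"
begin

(* Throughout, R^n is the type real^'n with n = CARD('n); in particular n >= 1. *)

(* Polynomials in variables indexed by 'n, as finitely supported maps from exponent vectors to
   coefficients. *)
type_synonym 'n mpoly = "('n \<Rightarrow>\<^sub>0 nat) \<Rightarrow>\<^sub>0 real"

definition mpoly_eval :: "'n::finite mpoly \<Rightarrow> real^'n \<Rightarrow> real" where
  "mpoly_eval P x =
     (\<Sum>m\<in>Poly_Mapping.keys P. Poly_Mapping.lookup P m * (\<Prod>i\<in>UNIV. (x $ i) ^ Poly_Mapping.lookup m i))"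

(* Total degree; the zero polynomial gets degree 0. *)
definition mpoly_degree :: "'n::finite mpoly \<Rightarrow> nat" where
  "mpoly_degree P =
     Max (insert 0 ((\<lambda>m. \<Sum>i\<in>UNIV. Poly_Mapping.lookup m i) ` Poly_Mapping.keys P))"

(* Formal partial derivative. If the exponent of variable i in m is 0, the exponent subtraction
   truncates, but the coefficient is then 0. *)
definition mpoly_deriv :: "'n::finite \<Rightarrow> 'n mpoly \<Rightarrow> 'n mpoly" where
  "mpoly_deriv i P =
     (\<Sum>m\<in>Poly_Mapping.keys P.
        Poly_Mapping.single (m - Poly_Mapping.single i 1)
          (Poly_Mapping.lookup P m * real (Poly_Mapping.lookup m i)))"

(* The lists of length k range over the partial derivatives of order k. *)
definition vanishes_to_order :: "nat \<Rightarrow> 'n::finite mpoly \<Rightarrow> real^'n \<Rightarrow> bool" where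
  "vanishes_to_order t P a \<longleftrightarrow>
     (\<forall>is. length is < t \<longrightarrow> mpoly_eval (foldr mpoly_deriv is P) a = 0)"

(* Extended-natural valued, so that the zero polynomial has multiplicity \<infinity>; for a nonzero
   polynomial the supremum is a maximum. *)
definition mpoly_mult :: "'n::finite mpoly \<Rightarrow> real^'n \<Rightarrow> enat" where
  "mpoly_mult P a = Sup {enat t | t. vanishes_to_order t P a}"

definition cube :: "(real^'n) set" where
  "cube = {x. \<forall>i. x $ i \<in> {0, 1}}"

definition affine_hyperplane :: "(real^'n) set \<Rightarrow> bool" where
  "affine_hyperplane H \<longleftrightarrow> (\<exists>a b. a \<noteq> 0 \<and> H = {x. a \<bullet> x = b})"

definition exact_hyperplane_cover ::
    "nat \<Rightarrow> nat \<Rightarrow> (real^'n) set \<Rightarrow> (real^'n) set multiset \<Rightarrow> bool" where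
  "exact_hyperplane_cover t l T \<H> \<longleftrightarrow>
     (\<forall>H\<in>#\<H>. affine_hyperplane H) \<and>
     (\<forall>a\<in>T. t \<le> size {#H \<in># \<H>. a \<in> H#}) \<and>
     (\<forall>b\<in>cube - T. size {#H \<in># \<H>. b \<in> H#} = l)"

definition exact_polynomial_cover ::
    "nat \<Rightarrow> nat \<Rightarrow> (real^'n::finite) set \<Rightarrow> 'n mpoly \<Rightarrow> bool" where
  "exact_polynomial_cover t l T P \<longleftrightarrow>
     P \<noteq> 0 \<and>
     (\<forall>a\<in>T. enat t \<le> mpoly_mult P a) \<and>
     (\<forall>b\<in>cube - T. mpoly_mult P b = enat l)"

(* Minima over subsets of the extended naturals: attained when a cover exists, and \<infinity> otherwise. *)
definition EHC :: "nat \<Rightarrow> nat \<Rightarrow> (real^'n) set \<Rightarrow> enat" where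
  "EHC t l T = Inf {enat (size \<H>) | \<H>. exact_hyperplane_cover t l T \<H>}"

definition EPC :: "nat \<Rightarrow> nat \<Rightarrow> (real^'n::finite) set \<Rightarrow> enat" where
  "EPC t l T = Inf {enat (mpoly_degree P) | P. exact_polynomial_cover t l T P}"

definition symmetric_set :: "(real^'n) set \<Rightarrow> bool" where
  "symmetric_set S \<longleftrightarrow> (\<forall>x\<in>S. \<forall>\<pi>. bij \<pi> \<longrightarrow> (\<chi> i. x $ \<pi> i) \<in> S)"

(* Used on points of the cube only, where the nonzero coordinates are those equal to 1. *)
definition hamming_weight :: "real^'n \<Rightarrow> nat" where
  "hamming_weight x = card {i. x $ i \<noteq> 0}"

definition weight_set :: "(real^'n) set \<Rightarrow> nat set" where
  "weight_set S = hamming_weight ` S"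

(* [0, i-1] \<union> [n-i+1, n], for i \<le> n; the first interval is empty for i = 0. *)
definition peripheral_interval :: "nat \<Rightarrow> nat \<Rightarrow> nat set" where
  "peripheral_interval n i = {..<i} \<union> {n - i + 1..n}"

definition mu :: "(real^'n) set \<Rightarrow> nat" where
  "mu S = Max {i. i \<le> nat \<lceil>real CARD('n) / 2\<rceil> \<and> peripheral_interval CARD('n) i \<subseteq> weight_set S}"

(* The subtraction does not truncate: [0, mu S - 1] is contained in weight_set S. *)
definition Lambda :: "(real^'n) set \<Rightarrow> nat" where
  "Lambda S = card (weight_set S) - mu S"

definition Lambda_bar :: "(real^'n) set \<Rightarrow> nat" where
  "Lambda_bar S = Lambda (cube - S)"

end

(* Lower bound. With Y_i = X_i^2 - X_i, every polynomial P is a sum of Y^alpha * G_alpha with G_alpha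
   multilinear and deg G_alpha + 2 |alpha| <= deg P. Since Y_i vanishes to order exactly 1 at each
   cube point, vanishing to order t - 1 on the whole cube forces G_alpha = 0 for |alpha| < t - 1,
   and P vanishes to order t at a cube point iff all G_alpha with |alpha| = t - 1 vanish there.
   Take a point p of weight mu or n - mu outside T, the complement of S (maximality of mu provides
   one), and alpha with G_alpha(p) nonzero; G_alpha vanishes on T. On the subcube of the points
   above (respectively below) p, multiply G_alpha by one layer form sum X_i - w for every missed
   weight w: the product is nonzero at p only, so its degree is at least the dimension of the
   subcube.

   Upper bound. Take t - 1 copies of each of the hyperplanes x_i = 0 and x_i = 1, mu hyperplanes
   covering exactly the peripheral layers, and one hyperplane for each remaining layer of T. The
   product of the affine forms of a hyperplane cover is a polynomial cover. *)
theory Submission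
  imports Defs
begin

declare One_nat_def [simp del]

section \<open>Evaluation, derivatives and degree of formal polynomials\<close>

abbreviation Const :: "real \<Rightarrow> 'n::finite mpoly" where
  "Const \<equiv> Poly_Mapping.single 0"

abbreviation Var :: "'n::finite \<Rightarrow> 'n mpoly" where
  "Var i \<equiv> Poly_Mapping.single (Poly_Mapping.single i 1) 1"

abbreviation total :: "('n::finite \<Rightarrow>\<^sub>0 nat) \<Rightarrow> nat" where
  "total m \<equiv> \<Sum>i\<in>UNIV. Poly_Mapping.lookup m i"

lemma mpoly_sum_monomials:
  "P = (\<Sum>m\<in>Poly_Mapping.keys P. Poly_Mapping.single m (Poly_Mapping.lookup P m))"
proof (rule poly_mapping_eqI)
  fix k
  show "Poly_Mapping.lookup P k = Poly_Mapping.lookup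
          (\<Sum>m\<in>Poly_Mapping.keys P. Poly_Mapping.single m (Poly_Mapping.lookup P m)) k"
    by (simp add: lookup_sum lookup_single when_def sum.delta' in_keys_iff)
qed

text \<open>Reduces identities that are additive in a polynomial to monomials; for products it is
  applied to each factor in turn.\<close>

lemma mpoly_induct [case_names single add]:
  fixes P :: "'n::finite mpoly"
  assumes "\<And>m c. Q (Poly_Mapping.single m c)" "\<And>P P'. Q P \<Longrightarrow> Q P' \<Longrightarrow> Q (P + P')"
  shows "Q P"
proof -
  have "Q 0" using assms(1)[of 0 0] by simp
  then have "Q (\<Sum>m\<in>A. Poly_Mapping.single m (Poly_Mapping.lookup P m))" for A
    by (induction A rule: infinite_finite_induct) (auto intro: assms)
  then show ?thesis using mpoly_sum_monomials[of P] by metis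
qed

lemma eval_add: "mpoly_eval (P + Q) x = mpoly_eval P x + mpoly_eval Q x"
  unfolding mpoly_eval_def
  by (rule setsum_keys_plus_distrib[where
        f = "\<lambda>m c. c * (\<Prod>i\<in>UNIV. (x $ i) ^ Poly_Mapping.lookup m i)"])
     (simp_all add: distrib_right)

lemma eval_single:
  "mpoly_eval (Poly_Mapping.single m c) x = c * (\<Prod>i\<in>UNIV. (x $ i) ^ Poly_Mapping.lookup m i)"
  by (simp add: mpoly_eval_def)

lemma eval_0 [simp]: "mpoly_eval 0 x = 0"
  by (simp add: mpoly_eval_def)

lemma eval_Const [simp]: "mpoly_eval (Const c) x = c"
  by (simp add: eval_single)

lemma eval_1 [simp]: "mpoly_eval 1 x = 1"
  using eval_Const[of 1 x] by (simp del: eval_Const)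

lemma eval_Var [simp]: "mpoly_eval (Var i) x = x $ i"
proof -
  have "(\<Prod>j\<in>UNIV. (x $ j) ^ Poly_Mapping.lookup (Poly_Mapping.single i (1::nat)) j)
      = (\<Prod>j\<in>UNIV. if j = i then x $ i else 1)"
    by (rule prod.cong) (auto simp: lookup_single when_def)
  then show ?thesis by (simp add: eval_single)
qed

lemma eval_mult: "mpoly_eval (P * Q) x = mpoly_eval P x * mpoly_eval Q x"
proof (induction P rule: mpoly_induct)
  case (single m c)
  show ?case
    by (induction Q rule: mpoly_induct)
       (simp_all add: mult_single eval_single eval_add distrib_left lookup_add power_add
         prod.distrib)
qed (simp add: eval_add distrib_right)

lemma eval_diff: "mpoly_eval (P - Q) x = mpoly_eval P x - mpoly_eval Q x"
  using eval_add[of "P - Q" Q x] by simp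

lemma eval_sum: "mpoly_eval (sum F A) x = (\<Sum>i\<in>A. mpoly_eval (F i) x)"
  by (induction A rule: infinite_finite_induct) (simp_all add: eval_add)

lemma eval_prod: "mpoly_eval (prod F A) x = (\<Prod>i\<in>A. mpoly_eval (F i) x)"
  by (induction A rule: infinite_finite_induct) (simp_all add: eval_mult)

lemma eval_prod_mset: "mpoly_eval (\<Prod>\<^sub># (image_mset F M)) x = (\<Prod>i\<in>#M. mpoly_eval (F i) x)"
  by (induction M) (simp_all add: eval_mult)

lemma eval_power: "mpoly_eval (P ^ k) x = mpoly_eval P x ^ k"
  by (induction k) (simp_all add: eval_mult)

lemmas eval_simps = eval_add eval_diff eval_mult eval_sum eval_prod eval_power

lemma deriv_add: "mpoly_deriv i (P + Q) = mpoly_deriv i P + mpoly_deriv i Q"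
  unfolding mpoly_deriv_def
  by (rule setsum_keys_plus_distrib[where
        f = "\<lambda>m c. Poly_Mapping.single (m - Poly_Mapping.single i 1)
               (c * real (Poly_Mapping.lookup m i))"])
     (simp_all add: distrib_right single_add)

lemma deriv_single:
  "mpoly_deriv i (Poly_Mapping.single m c) =
   Poly_Mapping.single (m - Poly_Mapping.single i 1) (c * real (Poly_Mapping.lookup m i))"
  by (simp add: mpoly_deriv_def)

lemma deriv_0 [simp]: "mpoly_deriv i 0 = 0"
  by (simp add: mpoly_deriv_def)

lemma minus_single_add:
  fixes m m' :: "'n::finite \<Rightarrow>\<^sub>0 nat"
  assumes "Poly_Mapping.lookup m i > 0"
  shows "m - Poly_Mapping.single i 1 + m' = m + m' - Poly_Mapping.single i 1"
  using assms by (intro poly_mapping_eqI) (auto simp: lookup_add lookup_minus lookup_single when_def)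

lemma deriv_mult: "mpoly_deriv i (P * Q) = mpoly_deriv i P * Q + P * mpoly_deriv i Q"
proof (induction P rule: mpoly_induct)
  case (single m c)
  show ?case
  proof (induction Q rule: mpoly_induct)
    case (single m' c')
    \<comment> \<open>Truncated subtraction may make the two exponents differ when \<open>i\<close>
      does not occur in \<open>m\<close>, but then both coefficients are 0.\<close>
    have 1: "Poly_Mapping.single (m - Poly_Mapping.single i 1 + m') (c * real (Poly_Mapping.lookup m i) * c')
      = Poly_Mapping.single (m + m' - Poly_Mapping.single i 1) (c * real (Poly_Mapping.lookup m i) * c')"
      by (cases "Poly_Mapping.lookup m i = 0") (simp_all add: minus_single_add)
    have 2: "Poly_Mapping.single (m + (m' - Poly_Mapping.single i 1)) (c * (c' * real (Poly_Mapping.lookup m' i)))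
      = Poly_Mapping.single (m + m' - Poly_Mapping.single i 1) (c * (c' * real (Poly_Mapping.lookup m' i)))"
      by (cases "Poly_Mapping.lookup m' i = 0")
         (use minus_single_add[of m' i m] in \<open>simp_all add: add.commute\<close>)
    show ?case
      unfolding mult_single deriv_single 1 2 single_add[symmetric]
      by (simp add: lookup_add algebra_simps)
  qed (simp add: deriv_add distrib_left add_ac)
qed (simp add: deriv_add distrib_right add_ac)

lemma degree_le_iff:
  "mpoly_degree P \<le> d \<longleftrightarrow> (\<forall>m\<in>Poly_Mapping.keys P. total m \<le> d)"
  by (auto simp: mpoly_degree_def)

lemma total_add: "total (m + m') = total m + total m'"
  by (simp add: lookup_add sum.distrib)

lemma total_single: "total (Poly_Mapping.single i k) = k"
  by (simp add: lookup_single when_def)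

lemma degree_mult: "mpoly_degree (P * Q) \<le> mpoly_degree P + mpoly_degree Q"
  unfolding degree_le_iff
proof
  fix m assume "m \<in> Poly_Mapping.keys (P * Q)"
  then obtain a b where "a \<in> Poly_Mapping.keys P" "b \<in> Poly_Mapping.keys Q" "m = a + b"
    using keys_mult[of P Q] by blast
  moreover have "total a \<le> mpoly_degree P" "total b \<le> mpoly_degree Q"
    using calculation degree_le_iff by blast+
  ultimately show "total m \<le> mpoly_degree P + mpoly_degree Q"
    by (simp add: total_add)
qed

lemma degree_prod_mset_le:
  assumes "\<And>x. x \<in># M \<Longrightarrow> mpoly_degree (F x) \<le> 1"
  shows "mpoly_degree (\<Prod>\<^sub># (image_mset F M)) \<le> size M"
  using assms
proof (induction M)
  case empty
  have "mpoly_degree (1 :: 'b mpoly) \<le> 0" unfolding degree_le_iff by simp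
  then show ?case by simp
next
  case (add x M)
  have "mpoly_degree (F x) \<le> 1" using add.prems by simp
  moreover have "mpoly_degree (\<Prod>\<^sub># (image_mset F M)) \<le> size M" using add by simp
  ultimately show ?case
    using degree_mult[of "F x" "\<Prod>\<^sub># (image_mset F M)"] by simp
qed

definition affine_form :: "real^'n::finite \<Rightarrow> real \<Rightarrow> 'n mpoly" where
  "affine_form a b = (\<Sum>i\<in>UNIV. Const (a $ i) * Var i) - Const b"

lemma eval_affine_form [simp]: "mpoly_eval (affine_form a b) x = a \<bullet> x - b"
  by (simp add: affine_form_def eval_simps inner_vec_def)

lemma degree_affine_form: "mpoly_degree (affine_form a b) \<le> 1"
  unfolding degree_le_iff
proof
  fix m assume "m \<in> Poly_Mapping.keys (affine_form a b)"
  then have "m \<in> Poly_Mapping.keys (\<Sum>i\<in>UNIV. Const (a $ i) * Var i) \<union> Poly_Mapping.keys (Const b :: 'a mpoly)"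
    unfolding affine_form_def by (rule subsetD[OF keys_diff])
  then consider i where "m \<in> Poly_Mapping.keys (Const (a $ i) * Var i)"
    | "m \<in> Poly_Mapping.keys (Const b :: 'a mpoly)"
    using subsetD[OF keys_sum[of "\<lambda>i. Const (a $ i) * Var i" UNIV], of m] by auto
  then have "m = 0 \<or> (\<exists>i. m = Poly_Mapping.single i 1)"
    by cases (auto simp: mult_single split: if_splits)
  then show "total m \<le> 1" by (auto simp: total_single)
qed

subsection \<open>Orders of vanishing\<close>

lemma vanishes_0 [simp]: "vanishes_to_order 0 P a"
  by (simp add: vanishes_to_order_def)

text \<open>\<open>foldr\<close> applies the last entry of the list first, so splitting off that
  entry differentiates \<open>P\<close> once before the rest. This recursion replaces the lists of
  derivatives in all inductions on the order.\<close>

lemma vanishes_Suc: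
  "vanishes_to_order (Suc t) P a \<longleftrightarrow>
   mpoly_eval P a = 0 \<and> (\<forall>i. vanishes_to_order t (mpoly_deriv i P) a)"
  (is "?L \<longleftrightarrow> ?R")
proof
  assume L: ?L
  have "mpoly_eval (foldr mpoly_deriv (is @ [i]) P) a = 0" if "length is < t" for "is" i
    using L that unfolding vanishes_to_order_def by (metis length_append_singleton Suc_mono)
  moreover have "mpoly_eval (foldr mpoly_deriv [] P) a = 0"
    using L unfolding vanishes_to_order_def by (metis list.size(3) zero_less_Suc)
  ultimately show ?R by (simp add: vanishes_to_order_def)
next
  assume R: ?R
  show ?L unfolding vanishes_to_order_def
  proof (intro allI impI)
    fix "is" :: "'a list" assume "length is < Suc t"
    then show "mpoly_eval (foldr mpoly_deriv is P) a = 0"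
      using R by (cases "is" rule: rev_cases) (auto simp: vanishes_to_order_def)
  qed
qed

lemma vanishes_mono: "vanishes_to_order t P a \<Longrightarrow> s \<le> t \<Longrightarrow> vanishes_to_order s P a"
  by (auto simp: vanishes_to_order_def)

lemma vanishes_zero: "vanishes_to_order t 0 a"
  by (induction t) (simp_all add: vanishes_Suc)

lemma vanishes_add:
  "vanishes_to_order t P a \<Longrightarrow> vanishes_to_order t Q a \<Longrightarrow> vanishes_to_order t (P + Q) a"
  by (induction t arbitrary: P Q) (auto simp: vanishes_Suc eval_add deriv_add)

lemma vanishes_sum:
  "(\<And>i. i \<in> A \<Longrightarrow> vanishes_to_order t (F i) a) \<Longrightarrow> vanishes_to_order t (sum F A) a"
  by (induction A rule: infinite_finite_induct) (auto simp: vanishes_zero vanishes_add)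

lemma vanishes_1: "vanishes_to_order 1 P a \<longleftrightarrow> mpoly_eval P a = 0"
  by (simp add: vanishes_Suc One_nat_def)

text \<open>By the product rule a derivative of \<open>P * Q\<close> is a sum of two products, in
  each of which only one factor loses one order; hence induction on \<open>s + t\<close>.\<close>

lemma vanishes_mult:
  "vanishes_to_order s P a \<Longrightarrow> vanishes_to_order t Q a \<Longrightarrow> vanishes_to_order (s + t) (P * Q) a"
proof (induction "s + t" arbitrary: s t P Q)
  case (Suc r)
  have "vanishes_to_order r (mpoly_deriv i P * Q + P * mpoly_deriv i Q) a" for i
  proof (rule vanishes_add)
    show "vanishes_to_order r (mpoly_deriv i P * Q) a"
    \<comment> \<open>If \<open>s = 0\<close> nothing is lost by differentiating \<open>P\<close>,
      and the order of \<open>Q\<close> is lowered to \<open>t - 1\<close> to match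
      \<open>r\<close>.\<close>
    proof (cases s)
      case 0
      then have "r = 0 + (t - 1)" using Suc.hyps by simp
      then show ?thesis
        using Suc.hyps(1)[of 0 "t - 1" "mpoly_deriv i P" Q] Suc.prems vanishes_mono by force
    next
      case (Suc s')
      then show ?thesis
        using Suc.hyps(1)[of s' t "mpoly_deriv i P" Q] \<open>Suc r = s + t\<close> Suc.prems
        by (auto simp: vanishes_Suc)
    qed
    show "vanishes_to_order r (P * mpoly_deriv i Q) a"
    proof (cases t)
      case 0
      then have "r = (s - 1) + 0" using Suc.hyps by simp
      then show ?thesis
        using Suc.hyps(1)[of "s - 1" 0 P "mpoly_deriv i Q"] Suc.prems vanishes_mono by force
    next
      case (Suc t')
      then show ?thesis
        using Suc.hyps(1)[of s t' P "mpoly_deriv i Q"] \<open>Suc r = s + t\<close> Suc.prems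
        by (auto simp: vanishes_Suc)
    qed
  qed
  moreover have "mpoly_eval (P * Q) a = 0"
  proof -
    have "s > 0 \<or> t > 0" using Suc.hyps(2) by auto
    then show ?thesis using Suc.prems vanishes_mono[of s P a 1] vanishes_mono[of t Q a 1]
      by (auto simp: eval_mult vanishes_1)
  qed
  ultimately show ?case unfolding Suc.hyps(2)[symmetric] by (simp add: vanishes_Suc deriv_mult)
qed simp

lemma vanishes_power: "vanishes_to_order s P a \<Longrightarrow> vanishes_to_order (s * k) (P ^ k) a"
  by (induction k) (simp_all add: vanishes_mult)

lemma vanishes_prod:
  "(\<And>i. i \<in> A \<Longrightarrow> vanishes_to_order (f i) (F i) a) \<Longrightarrow> vanishes_to_order (sum f A) (prod F A) a"
  by (induction A rule: infinite_finite_induct) (auto simp: vanishes_mult)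

text \<open>The set of admissible orders is downward closed, so every finite bound below its
  supremum belongs to it, even when the supremum is infinite.\<close>

lemma enat_le_mult_iff: "enat t \<le> mpoly_mult P a \<longleftrightarrow> vanishes_to_order t P a"
proof
  assume *: "enat t \<le> mpoly_mult P a"
  show "vanishes_to_order t P a"
  proof (cases t)
    case (Suc r)
    then have "enat r < mpoly_mult P a" using * Suc_ile_eq by blast
    then obtain k where "vanishes_to_order k P a" "r < k"
      unfolding mpoly_mult_def less_Sup_iff by auto
    then show ?thesis using Suc vanishes_mono by (metis Suc_leI)
  qed simp
qed (auto simp: mpoly_mult_def intro: Sup_upper)

lemma mult_eq_iff:
  "mpoly_mult P a = enat l \<longleftrightarrow> vanishes_to_order l P a \<and> \<not> vanishes_to_order (Suc l) P a"
  by (metis enat_le_mult_iff Suc_ile_eq linorder_not_less order_antisym_conv order_refl)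

section \<open>Growth of polynomials along lines\<close>

lemma deriv_eval_line:
  "((\<lambda>s. mpoly_eval P (a + s *\<^sub>R v)) has_real_derivative
     (\<Sum>i\<in>UNIV. v $ i * mpoly_eval (mpoly_deriv i P) (a + s *\<^sub>R v))) (at s)"
proof (induction P rule: mpoly_induct)
  case (single m c)
  let ?x = "a + s *\<^sub>R v"
  have e: "mpoly_eval (mpoly_deriv i (Poly_Mapping.single m c)) ?x =
     c * (real (Poly_Mapping.lookup m i) * (?x $ i) ^ (Poly_Mapping.lookup m i - 1)) *
       (\<Prod>j\<in>UNIV - {i}. (?x $ j) ^ Poly_Mapping.lookup m j)" for i
  proof -
    have "(\<Prod>j\<in>UNIV. (?x $ j) ^ Poly_Mapping.lookup (m - Poly_Mapping.single i 1) j) =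
      (?x $ i) ^ (Poly_Mapping.lookup m i - 1) * (\<Prod>j\<in>UNIV - {i}. (?x $ j) ^ Poly_Mapping.lookup m j)"
      by (subst prod.remove[of _ i])
         (auto simp: lookup_minus lookup_single when_def intro!: prod.cong)
    then show ?thesis by (simp add: deriv_single eval_single)
  qed
  have "((\<lambda>s. \<Prod>i\<in>UNIV. (a $ i + s * v $ i) ^ Poly_Mapping.lookup m i) has_real_derivative
     (\<Sum>i\<in>UNIV. (real (Poly_Mapping.lookup m i) * (v $ i * (a $ i + s * v $ i) ^ (Poly_Mapping.lookup m i - 1))) *
        (\<Prod>j\<in>UNIV - {i}. (a $ j + s * v $ j) ^ Poly_Mapping.lookup m j))) (at s)"
    by (rule has_field_derivative_prod) (auto intro!: derivative_eq_intros simp: One_nat_def)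
  from DERIV_cmult[OF this, of c] show ?case
    unfolding e by (simp add: eval_single sum_distrib_left mult_ac)
next
  case (add P P')
  from DERIV_add[OF this] show ?case
    by (simp add: eval_add deriv_add distrib_left sum.distrib)
qed

lemma tendsto_eval_line:
  "((\<lambda>s. mpoly_eval P (a + s *\<^sub>R v)) \<longlongrightarrow> mpoly_eval P a) (at (0::real))"
  using DERIV_isCont[OF deriv_eval_line[of P a v 0]] by (simp add: isCont_def)

text \<open>Induction by l'Hopital's rule: the derivative along the line is a linear combination of
  partial derivatives, each vanishing to one order less. Later uses refute a high order of vanishing
  by exhibiting a line with slower decay.\<close>

lemma vanishes_imp_tendsto:
  assumes "vanishes_to_order (Suc k) P a"
  shows "((\<lambda>s. mpoly_eval P (a + s *\<^sub>R v) / s ^ k) \<longlongrightarrow> 0) (at (0::real))"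
  using assms
proof (induction k arbitrary: P)
  case 0
  then show ?case using tendsto_eval_line[of P a v] by (simp add: vanishes_Suc)
next
  case (Suc k)
  let ?D = "\<lambda>s. \<Sum>i\<in>UNIV. v $ i * mpoly_eval (mpoly_deriv i P) (a + s *\<^sub>R v)"
  have "((\<lambda>s. (\<Sum>i\<in>UNIV. v $ i * (mpoly_eval (mpoly_deriv i P) (a + s *\<^sub>R v) / s ^ k)) / real (Suc k))
      \<longlongrightarrow> (\<Sum>i\<in>UNIV. v $ i * 0) / real (Suc k)) (at 0)"
    using Suc by (intro tendsto_intros) (auto simp: vanishes_Suc)
  then have lim: "((\<lambda>s. ?D s / (real (Suc k) * s ^ k)) \<longlongrightarrow> 0) (at 0)"
    by (simp add: sum_divide_distrib mult_ac)
  show ?case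
  proof (rule lhopital)
    show "((\<lambda>s. mpoly_eval P (a + s *\<^sub>R v)) \<longlongrightarrow> 0) (at (0::real))"
      using tendsto_eval_line[of P a v] Suc.prems by (simp add: vanishes_Suc)
    show "((\<lambda>s::real. s ^ Suc k) \<longlongrightarrow> 0) (at 0)"
      by (rule tendsto_eq_intros tendsto_null_power | simp)+
    show "eventually (\<lambda>s::real. s ^ Suc k \<noteq> 0) (at 0)" "eventually (\<lambda>s::real. real (Suc k) * s ^ k \<noteq> 0) (at 0)"
      unfolding eventually_at_filter by auto
    show "\<forall>\<^sub>F s in at 0. ((\<lambda>s. s ^ Suc k) has_real_derivative real (Suc k) * s ^ k) (at s)"
      using DERIV_pow[of "Suc k"] by (intro always_eventually allI) simp
    show "\<forall>\<^sub>F s in at 0. ((\<lambda>s. mpoly_eval P (a + s *\<^sub>R v)) has_real_derivative ?D s) (at s)"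
      by (intro always_eventually allI deriv_eval_line)
  qed (rule lim)
qed

text \<open>Finitely many hyperplanes through the origin have measure zero, so they do not fill the
  space.\<close>

lemma generic_direction:
  fixes A :: "(real^'n::finite) set"
  assumes "finite A" "0 \<notin> A"
  obtains v where "\<And>a. a \<in> A \<Longrightarrow> a \<bullet> v \<noteq> 0"
proof -
  have "negligible (\<Union>a\<in>A. {x. a \<bullet> x = 0})"
    using assms by (intro negligible_Union) (auto intro!: negligible_hyperplane)
  then have "(\<Union>a\<in>A. {x. a \<bullet> x = 0}) \<noteq> UNIV" by auto
  then show ?thesis using that by blast
qed

subsection \<open>Expansion in powers of the vanishing forms of the cube\<close>

text \<open>Substituting \<open>exp (s w\<^sub>j)\<close> for the variables, with \<open>w\<close> generic, separates the monomials by
  their growth rate as \<open>s\<close> tends to infinity.\<close>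

lemma monomials_independent:
  fixes A :: "('n::finite \<Rightarrow> nat) set" and c :: "('n \<Rightarrow> nat) \<Rightarrow> real"
  assumes "finite A"
    and zero: "\<And>u :: real^'n. (\<Sum>\<alpha>\<in>A. c \<alpha> * (\<Prod>j\<in>UNIV. (u $ j) ^ \<alpha> j)) = 0"
    and "\<alpha> \<in> A"
  shows "c \<alpha> = 0"
proof (rule ccontr)
  assume "c \<alpha> \<noteq> 0"
  \<comment> \<open>Only exponents with nonzero coefficient are kept, so that the fastest growing
    term cannot be absent.\<close>
  define A' where "A' = {\<alpha>\<in>A. c \<alpha> \<noteq> 0}"
  have A': "finite A'" "A' \<noteq> {}" using assms \<open>c \<alpha> \<noteq> 0\<close> by (auto simp: A'_def)
  let ?vec = "\<lambda>\<alpha>. \<chi> j. real (\<alpha> j)"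
  have vec_inj: "?vec \<alpha> = ?vec \<beta> \<longleftrightarrow> \<alpha> = \<beta>" for \<alpha> \<beta> :: "'n \<Rightarrow> nat"
    by (auto simp: vec_eq_iff)
  \<comment> \<open>\<open>w\<close> is orthogonal to no difference of distinct exponents in
    \<open>A'\<close>, hence the growth rates \<open>l\<close> are distinct there.\<close>
  obtain w where w: "\<And>v. v \<in> (\<lambda>(\<alpha>, \<beta>). ?vec \<alpha> - ?vec \<beta>) ` (A' \<times> A') - {0} \<Longrightarrow> v \<bullet> w \<noteq> 0"
    using generic_direction[of "(\<lambda>(\<alpha>, \<beta>). ?vec \<alpha> - ?vec \<beta>) ` (A' \<times> A') - {0}"] A' by auto
  define l where "l = (\<lambda>\<alpha>. ?vec \<alpha> \<bullet> w)"
  have l_inj: "l \<alpha> \<noteq> l \<beta>" if "\<alpha> \<in> A'" "\<beta> \<in> A'" "\<alpha> \<noteq> \<beta>" for \<alpha> \<beta>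
    using w[of "?vec \<alpha> - ?vec \<beta>"] that vec_inj[of \<alpha> \<beta>]
    by (force simp: l_def inner_diff_left)
  have "Max (l ` A') \<in> l ` A'" using A' by simp
  then obtain \<beta> where "\<beta> \<in> A'" "l \<beta> = Max (l ` A')" by (metis imageE)
  then have \<beta>: "\<beta> \<in> A'" "\<And>\<alpha>. \<alpha> \<in> A' \<Longrightarrow> l \<alpha> \<le> l \<beta>"
    using A' by simp_all
  have less: "l \<alpha> < l \<beta>" if "\<alpha> \<in> A'" "\<alpha> \<noteq> \<beta>" for \<alpha>
    using \<beta> that l_inj[of \<alpha> \<beta>] by fastforce
  \<comment> \<open>Division by the dominant exponential leaves negative rates except at \<beta>, so
    the limit isolates \<open>c \<beta>\<close>.\<close>
  have eq: "(\<Sum>\<alpha>\<in>A'. c \<alpha> * exp (s * (l \<alpha> - l \<beta>))) = 0" for s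
  proof -
    let ?u = "\<chi> j. exp (s * w $ j)"
    have "(\<Prod>j\<in>UNIV. (?u $ j) ^ \<alpha> j) = exp (s * l \<alpha>)" for \<alpha> :: "'n \<Rightarrow> nat"
      by (simp add: l_def inner_vec_def exp_sum sum_distrib_left flip: exp_of_nat_mult)
         (simp add: mult_ac)
    then have "(\<Sum>\<alpha>\<in>A. c \<alpha> * exp (s * l \<alpha>)) = 0" using zero[of ?u] by simp
    moreover have "(\<Sum>\<alpha>\<in>A. c \<alpha> * exp (s * l \<alpha>)) = (\<Sum>\<alpha>\<in>A'. c \<alpha> * exp (s * l \<alpha>))"
      using \<open>finite A\<close> by (intro sum.mono_neutral_right) (auto simp: A'_def)
    ultimately have "(\<Sum>\<alpha>\<in>A'. c \<alpha> * exp (s * l \<alpha>)) * exp (- (s * l \<beta>)) = 0" by simp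
    then show ?thesis
      by (simp add: sum_distrib_right mult.assoc right_diff_distrib flip: exp_add)
  qed
  have "((\<lambda>s. c \<alpha> * exp (s * (l \<alpha> - l \<beta>))) \<longlongrightarrow> (if \<alpha> = \<beta> then c \<beta> else 0)) at_top"
    if "\<alpha> \<in> A'" for \<alpha>
  proof (cases "\<alpha> = \<beta>")
    case False
    have "((\<lambda>s. exp (s * (l \<alpha> - l \<beta>))) \<longlongrightarrow> 0) at_top"
      by (rule filterlim_compose[OF exp_at_bot])
         (use less[OF that False] in \<open>simp add: filterlim_tendsto_neg_mult_at_bot_iff
             filterlim_at_top_mult_tendsto_pos filterlim_ident mult.commute[of _ "l \<alpha> - l \<beta>"]
             filterlim_tendsto_neg_mult_at_bot[OF tendsto_const]\<close>)
    from tendsto_mult_left[OF this, of "c \<alpha>"] False show ?thesis by simp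
  qed simp
  then have "((\<lambda>s. \<Sum>\<alpha>\<in>A'. c \<alpha> * exp (s * (l \<alpha> - l \<beta>))) \<longlongrightarrow> (\<Sum>\<alpha>\<in>A'. if \<alpha> = \<beta> then c \<beta> else 0)) at_top"
    by (rule tendsto_sum)
  then have "((\<lambda>s::real. 0) \<longlongrightarrow> c \<beta>) at_top"
    using \<beta>(1) A'(1) by (simp add: eq sum.delta)
  then have "c \<beta> = 0" by (simp add: tendsto_const_iff)
  then show False using \<beta>(1) by (simp add: A'_def)
qed

definition vanisher :: "'n::finite \<Rightarrow> 'n mpoly" where
  "vanisher i = Var i * Var i - Var i"

definition vanisher_power :: "('n::finite \<Rightarrow> nat) \<Rightarrow> 'n mpoly" where
  "vanisher_power \<alpha> = (\<Prod>i\<in>UNIV. vanisher i ^ \<alpha> i)"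

lemma cube_coord: "a \<in> cube \<Longrightarrow> a $ i * a $ i = a $ i"
  by (auto simp: cube_def)

lemma vanishes_vanisher_power:
  assumes "a \<in> cube"
  shows "vanishes_to_order (sum \<alpha> UNIV) (vanisher_power \<alpha>) a"
  unfolding vanisher_power_def
proof (rule vanishes_prod)
  fix i
  have "vanishes_to_order 1 (vanisher i) a"
    using cube_coord[OF assms] by (simp add: vanishes_1 vanisher_def eval_simps)
  from vanishes_power[OF this, of "\<alpha> i"]
  show "vanishes_to_order (\<alpha> i) (vanisher i ^ \<alpha> i) a" by simp
qed

text \<open>At a cube point the derivative of X_i^2 - X_i is 2 a_i - 1, which is 1 or -1; each
  factor therefore yields exactly one power of \<open>s\<close> when v_i is nonzero.\<close>

lemma eval_vanisher_power_line:
  assumes "a \<in> cube"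
  shows "mpoly_eval (vanisher_power \<alpha>) (a + s *\<^sub>R v) =
    s ^ sum \<alpha> UNIV * (\<Prod>i\<in>UNIV. (v $ i * (2 * a $ i - 1) + s * (v $ i)\<^sup>2) ^ \<alpha> i)"
proof -
  have "mpoly_eval (vanisher i) (a + s *\<^sub>R v) = s * (v $ i * (2 * a $ i - 1) + s * (v $ i)\<^sup>2)" for i
    using cube_coord[OF assms, of i]
    by (simp add: vanisher_def eval_simps algebra_simps power2_eq_square)
  then show ?thesis
    by (simp add: vanisher_power_def eval_simps power_mult_distrib prod.distrib power_sum)
qed

text \<open>Restrict \<open>P\<close> to a line through \<open>a\<close> and divide by
  \<open>s ^ k\<close>. In the limit only the terms with |\<alpha>| = k remain, and they form a
  polynomial in the direction whose coefficients are the values \<open>G \<alpha>\<close> at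
  \<open>a\<close>, up to signs. Independence of monomials makes all of them 0. The converse adds
  the orders of the factors.\<close>

lemma vanishes_expansion_iff:
  fixes A :: "('n::finite \<Rightarrow> nat) set"
  assumes "finite A" and P: "P = (\<Sum>\<alpha>\<in>A. vanisher_power \<alpha> * G \<alpha>)"
    and low: "\<And>\<alpha>. \<alpha> \<in> A \<Longrightarrow> sum \<alpha> UNIV < k \<Longrightarrow> G \<alpha> = 0" and "a \<in> cube"
  shows "vanishes_to_order (Suc k) P a \<longleftrightarrow> (\<forall>\<alpha>\<in>A. sum \<alpha> UNIV = k \<longrightarrow> mpoly_eval (G \<alpha>) a = 0)"
proof
  assume V: "vanishes_to_order (Suc k) P a"
  \<comment> \<open>The quotient by \<open>s ^ k\<close>, written without division so that its limit
    at 0 is immediate. Where the exponent truncates, \<open>G \<alpha>\<close> is 0.\<close>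
  let ?h = "\<lambda>\<alpha> v s. s ^ (sum \<alpha> UNIV - k) *
      (\<Prod>i\<in>UNIV. (v $ i * (2 * a $ i - 1) + s * (v $ i)\<^sup>2) ^ \<alpha> i) * mpoly_eval (G \<alpha>) (a + s *\<^sub>R v)"
  have lim: "(\<Sum>\<alpha>\<in>A. 0 ^ (sum \<alpha> UNIV - k) *
      (\<Prod>i\<in>UNIV. (v $ i * (2 * a $ i - 1) + 0 * (v $ i)\<^sup>2) ^ \<alpha> i) * mpoly_eval (G \<alpha>) a) = 0"
    (is "?S = 0") for v :: "real^'n"
  proof -
    have "((\<lambda>s. \<Sum>\<alpha>\<in>A. ?h \<alpha> v s) \<longlongrightarrow> ?S) (at (0::real))"
      by (intro tendsto_intros tendsto_eval_line)
    moreover have "\<forall>\<^sub>F s in at (0::real). (\<Sum>\<alpha>\<in>A. ?h \<alpha> v s) = mpoly_eval P (a + s *\<^sub>R v) / s ^ k"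
    proof (rule eventually_mono[OF eventually_neq_at_within[of 0]])
      fix s :: real assume "s \<noteq> 0"
      have "?h \<alpha> v s = mpoly_eval (vanisher_power \<alpha> * G \<alpha>) (a + s *\<^sub>R v) / s ^ k" if "\<alpha> \<in> A" for \<alpha>
      proof (cases "sum \<alpha> UNIV < k")
        case True
        then show ?thesis using low[OF that] by simp
      next
        case False
        then show ?thesis using \<open>s \<noteq> 0\<close>
          by (simp add: eval_mult eval_vanisher_power_line[OF \<open>a \<in> cube\<close>] power_diff)
      qed
      then show "(\<Sum>\<alpha>\<in>A. ?h \<alpha> v s) = mpoly_eval P (a + s *\<^sub>R v) / s ^ k"
        by (simp add: P eval_sum sum_divide_distrib)
    qed
    ultimately have "((\<lambda>s. mpoly_eval P (a + s *\<^sub>R v) / s ^ k) \<longlongrightarrow> ?S) (at (0::real))"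
      by (rule Lim_transform_eventually)
    with vanishes_imp_tendsto[OF V] show ?thesis
      using LIM_unique by blast
  qed
  have "(\<Sum>\<alpha>\<in>A. (if sum \<alpha> UNIV = k then mpoly_eval (G \<alpha>) a else 0) * (\<Prod>j\<in>UNIV. (u $ j) ^ \<alpha> j)) = 0"
    for u :: "real^'n"
  proof -
    \<comment> \<open>Multiplication by 2 a_i - 1 is an involution, so a suitable direction produces
      any prescribed \<open>u\<close>.\<close>
    have e: "u $ i * (2 * a $ i - 1) * (2 * a $ i - 1) = u $ i" for i
      using cube_coord[OF \<open>a \<in> cube\<close>, of i] by (auto simp: algebra_simps)
    have "(\<Sum>\<alpha>\<in>A. 0 ^ (sum \<alpha> UNIV - k) * (\<Prod>i\<in>UNIV. (u $ i) ^ \<alpha> i) * mpoly_eval (G \<alpha>) a) = 0"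
      using lim[of "\<chi> i. u $ i * (2 * a $ i - 1)"]
      by (simp only: e vec_lambda_beta mult_zero_left add_0_right)
    \<comment> \<open>Here \<open>0 ^ 0 = 1\<close> selects |\<alpha>| = k: larger sums give a zero
      power, smaller ones a zero coefficient.\<close>
    moreover have "0 ^ (sum \<alpha> UNIV - k) * (\<Prod>i\<in>UNIV. (u $ i) ^ \<alpha> i) * mpoly_eval (G \<alpha>) a =
        (if sum \<alpha> UNIV = k then mpoly_eval (G \<alpha>) a else 0) * (\<Prod>j\<in>UNIV. (u $ j) ^ \<alpha> j)" if "\<alpha> \<in> A" for \<alpha>
      using low[OF that] by (cases "sum \<alpha> UNIV" k rule: linorder_cases) (auto simp: power_0_left)
    ultimately show ?thesis by simp
  qed
  from monomials_independent[OF \<open>finite A\<close> this]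
  show "\<forall>\<alpha>\<in>A. sum \<alpha> UNIV = k \<longrightarrow> mpoly_eval (G \<alpha>) a = 0" by metis
next
  assume R: "\<forall>\<alpha>\<in>A. sum \<alpha> UNIV = k \<longrightarrow> mpoly_eval (G \<alpha>) a = 0"
  show "vanishes_to_order (Suc k) P a"
    unfolding P
  proof (rule vanishes_sum)
    fix \<alpha> assume "\<alpha> \<in> A"
    note v = vanishes_vanisher_power[OF \<open>a \<in> cube\<close>, of \<alpha>]
    show "vanishes_to_order (Suc k) (vanisher_power \<alpha> * G \<alpha>) a"
    proof (cases "sum \<alpha> UNIV" k rule: linorder_cases)
      case less
      then show ?thesis using low[OF \<open>\<alpha> \<in> A\<close>] by (simp add: vanishes_zero)
    next
      case equal
      then have "vanishes_to_order 1 (G \<alpha>) a" using R \<open>\<alpha> \<in> A\<close> by (simp add: vanishes_1)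
      from vanishes_mult[OF v this] equal show ?thesis by (simp add: One_nat_def)
    next
      case greater
      then show ?thesis
        using vanishes_mult[OF v vanishes_0[of "G \<alpha>"]] vanishes_mono by fastforce
    qed
  qed
qed

definition multilinear :: "'n::finite mpoly \<Rightarrow> bool" where
  "multilinear G \<longleftrightarrow> (\<forall>m\<in>Poly_Mapping.keys G. \<forall>i. Poly_Mapping.lookup m i \<le> 1)"

text \<open>The bound \<open>d\<close> is a parameter, not the degree of \<open>P\<close>, so that
  expansions of the single monomials of a polynomial share one index set and can be added.\<close>

definition expandable :: "nat \<Rightarrow> 'n::finite mpoly \<Rightarrow> bool" where
  "expandable d P \<longleftrightarrow> (\<exists>G. P = (\<Sum>\<alpha> | 2 * sum \<alpha> UNIV \<le> d. vanisher_power \<alpha> * G \<alpha>) \<and>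
     (\<forall>\<alpha>. multilinear (G \<alpha>) \<and> mpoly_degree (G \<alpha>) \<le> d - 2 * sum \<alpha> UNIV))"

lemma finite_bounded_exponents: "finite {\<alpha> :: 'n::finite \<Rightarrow> nat. 2 * sum \<alpha> UNIV \<le> d}"
proof (rule finite_subset)
  have "\<alpha> i \<le> sum \<alpha> UNIV" for \<alpha> :: "'n \<Rightarrow> nat" and i by (simp add: member_le_sum)
  then show "{\<alpha> :: 'n \<Rightarrow> nat. 2 * sum \<alpha> UNIV \<le> d} \<subseteq> UNIV \<rightarrow>\<^sub>E {..d}"
    by (auto simp: PiE_UNIV_domain) (metis (no_types) add_leD1 le_trans mult_2)
qed (auto intro: finite_PiE)

lemma expandable_0: "expandable d 0"
  unfolding expandable_def by (rule exI[of _ "\<lambda>_. 0"]) (simp add: multilinear_def degree_le_iff)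

lemma expandable_add:
  assumes "expandable d P" "expandable d Q"
  shows "expandable d (P + Q)"
proof -
  obtain F G where "P = (\<Sum>\<alpha> | 2 * sum \<alpha> UNIV \<le> d. vanisher_power \<alpha> * F \<alpha>)"
    "Q = (\<Sum>\<alpha> | 2 * sum \<alpha> UNIV \<le> d. vanisher_power \<alpha> * G \<alpha>)"
    and *: "\<And>\<alpha>. multilinear (F \<alpha>) \<and> mpoly_degree (F \<alpha>) \<le> d - 2 * sum \<alpha> UNIV"
    "\<And>\<alpha>. multilinear (G \<alpha>) \<and> mpoly_degree (G \<alpha>) \<le> d - 2 * sum \<alpha> UNIV"
    using assms unfolding expandable_def by blast
  moreover have "multilinear (F \<alpha> + G \<alpha>) \<and> mpoly_degree (F \<alpha> + G \<alpha>) \<le> d - 2 * sum \<alpha> UNIV" for \<alpha>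
    using *[of \<alpha>] Poly_Mapping.keys_add[of "F \<alpha>" "G \<alpha>"]
    unfolding multilinear_def degree_le_iff by blast
  ultimately show ?thesis unfolding expandable_def
    by (intro exI[of _ "\<lambda>\<alpha>. F \<alpha> + G \<alpha>"]) (simp add: distrib_left sum.distrib)
qed

lemma vanisher_power_add_one:
  "vanisher_power (\<alpha>(i := Suc (\<alpha> i))) = vanisher i * vanisher_power \<alpha>"
  by (simp add: vanisher_power_def prod.remove[of UNIV i] mult_ac)

text \<open>Rewrite X_i^2 as Y_i + X_i wherever an exponent is at least 2. The first summand trades
  two degrees of the monomial for one factor Y_i, the second loses one degree, so the bound is kept
  while the total exponent drops.\<close>

lemma expandable_monomial:
  "total m + 2 * sum \<alpha> UNIV \<le> d \<Longrightarrow> expandable d (vanisher_power \<alpha> * Poly_Mapping.single m c)"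
proof (induction "total m" arbitrary: m \<alpha> rule: less_induct)
  case less
  show ?case
  proof (cases "\<forall>i. Poly_Mapping.lookup m i \<le> 1")
    case True
    \<comment> \<open>A multilinear monomial is its own expansion, with a single nonzero
      coefficient.\<close>
    let ?G = "\<lambda>\<beta>. if \<beta> = \<alpha> then Poly_Mapping.single m c else 0"
    have "(\<Sum>\<beta> | 2 * sum \<beta> UNIV \<le> d. vanisher_power \<beta> * ?G \<beta>) = (\<Sum>\<beta>\<in>{\<alpha>}. vanisher_power \<beta> * ?G \<beta>)"
      using less.prems finite_bounded_exponents by (intro sum.mono_neutral_right) auto
    moreover have "multilinear (?G \<beta>) \<and> mpoly_degree (?G \<beta>) \<le> d - 2 * sum \<beta> UNIV" for \<beta>
      using True less.prems by (auto simp: multilinear_def degree_le_iff)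
    ultimately show ?thesis unfolding expandable_def by (intro exI[of _ ?G]) simp
  next
    case False
    then obtain i where "\<not> Poly_Mapping.lookup m i \<le> 1" by blast
    then have i: "Poly_Mapping.lookup m i \<ge> 2" by simp
    define m' where "m' = m - Poly_Mapping.single i 2"
    have m: "m = Poly_Mapping.single i 1 + (Poly_Mapping.single i 1 + m')"
      using i by (intro poly_mapping_eqI)
        (auto simp: m'_def lookup_add lookup_minus lookup_single when_def)
    have tot: "total m = total m' + 2" unfolding m total_add total_single by simp
    have "Poly_Mapping.single m c = Var i * Var i * Poly_Mapping.single m' c"
      by (simp add: m mult_single add.assoc)
    also have "\<dots> = vanisher i * Poly_Mapping.single m' c
        + Poly_Mapping.single (Poly_Mapping.single i 1 + m') c"
      by (simp add: vanisher_def left_diff_distrib mult_single)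
    finally have "vanisher_power \<alpha> * Poly_Mapping.single m c =
        vanisher_power (\<alpha>(i := Suc (\<alpha> i))) * Poly_Mapping.single m' c
        + vanisher_power \<alpha> * Poly_Mapping.single (Poly_Mapping.single i 1 + m') c"
      by (simp add: vanisher_power_add_one distrib_left mult_ac)
    moreover have "sum (\<alpha>(i := Suc (\<alpha> i))) UNIV = Suc (sum \<alpha> UNIV)"
      by (simp add: sum.remove[of UNIV i])
    moreover have "total (Poly_Mapping.single i 1 + m') = total m' + 1"
      unfolding total_add total_single by simp
    ultimately show ?thesis
      using less.prems less.hyps[of m' "\<alpha>(i := Suc (\<alpha> i))"] tot
        less.hyps[of "Poly_Mapping.single i 1 + m'" \<alpha>]
      by (simp add: expandable_add)
  qed
qed

lemma expandable: "expandable (mpoly_degree P) P"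
proof -
  have "expandable (mpoly_degree P) (\<Sum>m\<in>M. Poly_Mapping.single m (Poly_Mapping.lookup P m))"
    if "M \<subseteq> Poly_Mapping.keys P" for M
    using finite_subset[OF that finite_keys] that
  proof (induction M rule: finite_induct)
    case (insert m M)
    have "total m \<le> mpoly_degree P" using insert.prems degree_le_iff by blast
    then have "expandable (mpoly_degree P) (Poly_Mapping.single m (Poly_Mapping.lookup P m))"
      using expandable_monomial[of m "\<lambda>_. 0" "mpoly_degree P"] by (simp add: vanisher_power_def)
    then show ?case using insert by (simp add: expandable_add)
  qed (simp add: expandable_0)
  then show ?thesis using mpoly_sum_monomials[of P] by (metis order_refl)
qed

subsection \<open>Polynomials on the cube\<close>

text \<open>Names cube points by their supports: weights become cardinalities, subcubes become
  intervals of sets, and coordinate permutations act on sets.\<close>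

definition ind :: "'n set \<Rightarrow> real^'n" where
  "ind X = (\<chi> i. of_bool (i \<in> X))"

lemma ind_in_cube [simp]: "ind X \<in> cube"
  by (simp add: ind_def cube_def)

lemma cubeE:
  assumes "x \<in> cube"
  obtains X where "x = ind X"
proof
  show "x = ind {i. x $ i \<noteq> 0}"
    using assms by (auto simp: ind_def cube_def vec_eq_iff)
qed

lemma hamming_weight_ind [simp]: "hamming_weight (ind X) = card X"
  by (simp add: hamming_weight_def ind_def)

lemma prod_ind:
  "(\<Prod>i\<in>UNIV. (ind X $ i) ^ Poly_Mapping.lookup m i) = of_bool (Poly_Mapping.keys m \<subseteq> X)"
proof -
  have "(ind X $ i) ^ Poly_Mapping.lookup m i = of_bool (i \<in> Poly_Mapping.keys m \<longrightarrow> i \<in> X)" for i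
    by (auto simp: ind_def in_keys_iff)
  then show ?thesis by (auto simp: prod_zero_iff subset_iff)
qed

lemma eval_ind:
  "mpoly_eval P (ind X) =
    (\<Sum>m\<in>Poly_Mapping.keys P. Poly_Mapping.lookup P m * of_bool (Poly_Mapping.keys m \<subseteq> X))"
  by (simp add: mpoly_eval_def prod_ind)

text \<open>Evaluate at the support of a monomial whose support has least size. No other monomial
  contributes, because a multilinear monomial is determined by its support.\<close>

lemma multilinear_eq_0:
  fixes G :: "'n::finite mpoly"
  assumes "multilinear G" "\<And>X. mpoly_eval G (ind X) = 0"
  shows "G = 0"
proof (rule ccontr)
  assume "G \<noteq> 0"
  then obtain m where m: "m \<in> Poly_Mapping.keys G"
    "\<And>m'. m' \<in> Poly_Mapping.keys G \<Longrightarrow> card (Poly_Mapping.keys m) \<le> card (Poly_Mapping.keys m')"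
    using ex_has_least_nat[of "\<lambda>m. m \<in> Poly_Mapping.keys G" _ "\<lambda>m. card (Poly_Mapping.keys m)"]
    by (metis keys_eq_empty ex_in_conv)
  have eq: "m' = m" if "m' \<in> Poly_Mapping.keys G" "Poly_Mapping.keys m' \<subseteq> Poly_Mapping.keys m" for m'
  proof (rule poly_mapping_eqI)
    fix i
    have "Poly_Mapping.keys m' = Poly_Mapping.keys m"
      using that m(2) by (simp add: card_subset_eq card_mono le_antisym)
    then have "Poly_Mapping.lookup m' i = 0 \<longleftrightarrow> Poly_Mapping.lookup m i = 0"
      by (metis in_keys_iff)
    moreover have "Poly_Mapping.lookup m' i \<le> 1" "Poly_Mapping.lookup m i \<le> 1"
      using assms(1) that(1) m(1) by (auto simp: multilinear_def)
    ultimately show "Poly_Mapping.lookup m' i = Poly_Mapping.lookup m i" by linarith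
  qed
  have "mpoly_eval G (ind (Poly_Mapping.keys m)) = (\<Sum>m'\<in>{m}. Poly_Mapping.lookup G m')"
    unfolding eval_ind using m(1) eq by (intro sum.mono_neutral_cong_right) auto
  then show False using assms(2) m(1) by (simp add: in_keys_iff)
qed

text \<open>Each monomial has fewer variables than \<open>Z\<close> has elements and so misses some
  \<open>z\<close> in \<open>Z\<close>; the terms for \<open>C\<close> and \<open>insert z C\<close>
  cancel.\<close>

lemma alternating_sum_eq_0:
  fixes P :: "'n::finite mpoly"
  assumes "mpoly_degree P < card Z"
  shows "(\<Sum>C\<in>Pow Z. (-1) ^ card C * mpoly_eval P (ind (U \<union> C))) = 0"
proof -
  have "(\<Sum>C\<in>Pow Z. (-1) ^ card C * of_bool (Poly_Mapping.keys m \<subseteq> U \<union> C)) = (0::real)"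
    if "m \<in> Poly_Mapping.keys P" for m
  proof -
    have "card (Poly_Mapping.keys m) = (\<Sum>i\<in>Poly_Mapping.keys m. 1)" by simp
    also have "\<dots> \<le> (\<Sum>i\<in>Poly_Mapping.keys m. Poly_Mapping.lookup m i)"
      by (intro sum_mono) (auto simp: in_keys_iff One_nat_def)
    also have "\<dots> \<le> total m" by (intro sum_mono2) auto
    also have "\<dots> \<le> mpoly_degree P" using that degree_le_iff by blast
    finally have "card (Poly_Mapping.keys m) < card Z" using assms by simp
    then obtain z where z: "z \<in> Z" "z \<notin> Poly_Mapping.keys m"
      by (metis card_mono finite_keys linorder_not_less subsetI)
    define Z' where "Z' = Z - {z}"
    have Z': "Z = insert z Z'" "z \<notin> Z'" "finite Z'" using z by (auto simp: Z'_def)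
    have inj: "inj_on (insert z) (Pow Z')" using Z' by (auto simp: inj_on_def)
    have disj: "Pow Z' \<inter> insert z ` Pow Z' = {}" using Z' by auto
    have split: "sum g (Pow Z) = (\<Sum>C\<in>Pow Z'. g C) + (\<Sum>C\<in>Pow Z'. g (insert z C))"
      for g :: "'n set \<Rightarrow> real"
      using \<open>finite Z'\<close> disj
      by (simp add: Z'(1) Pow_insert sum.union_disjoint sum.reindex[OF inj])
    have "(\<Sum>C\<in>Pow Z. (-1) ^ card C * of_bool (Poly_Mapping.keys m \<subseteq> U \<union> C)) =
      (\<Sum>C\<in>Pow Z'. (-1) ^ card C * of_bool (Poly_Mapping.keys m \<subseteq> U \<union> C)) +
      (\<Sum>C\<in>Pow Z'. (-1) ^ card (insert z C) * of_bool (Poly_Mapping.keys m \<subseteq> U \<union> insert z C) :: real)"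
      by (rule split)
    also have "(\<Sum>C\<in>Pow Z'. (-1) ^ card (insert z C) * of_bool (Poly_Mapping.keys m \<subseteq> U \<union> insert z C)) =
      (\<Sum>C\<in>Pow Z'. - ((-1) ^ card C * of_bool (Poly_Mapping.keys m \<subseteq> U \<union> C)) :: real)"
    proof (rule sum.cong[OF refl])
      fix C assume "C \<in> Pow Z'"
      then have "z \<notin> C" "finite C" using Z' by (auto intro: finite_subset)
      moreover have "Poly_Mapping.keys m \<subseteq> U \<union> insert z C \<longleftrightarrow> Poly_Mapping.keys m \<subseteq> U \<union> C"
        using z by auto
      ultimately show "(-1) ^ card (insert z C) * of_bool (Poly_Mapping.keys m \<subseteq> U \<union> insert z C) =
        - ((-1) ^ card C * of_bool (Poly_Mapping.keys m \<subseteq> U \<union> C) :: real)" by simp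
    qed
    finally show ?thesis by (simp add: sum_negf)
  qed
  then have "(\<Sum>m\<in>Poly_Mapping.keys P. Poly_Mapping.lookup P m *
      (\<Sum>C\<in>Pow Z. (-1) ^ card C * of_bool (Poly_Mapping.keys m \<subseteq> U \<union> C))) = 0" by simp
  then show ?thesis
    unfolding eval_ind sum_distrib_left by (subst sum.swap) (simp add: mult_ac)
qed

lemma hyperplane_weight: "(1 :: real^'n::finite) \<bullet> ind X = real (card X)"
  by (simp add: inner_vec_def ind_def)

text \<open>Being the only subset of \<open>Z\<close> of its size, \<open>X\<close> is empty or all
  of \<open>Z\<close>: the point is the bottom or top vertex of the subcube of sets between
  \<open>U\<close> and \<open>U \<union> Z\<close>. It is thus alone on its layer there, and layer
  forms can remove the other vertices without affecting it.\<close>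

lemma subcube_degree:
  fixes P :: "'n::finite mpoly"
  assumes "U \<inter> Z = {}" and "X \<subseteq> Z" and uniq: "\<And>C. C \<subseteq> Z \<Longrightarrow> card C = card X \<Longrightarrow> C = X"
    and nz: "mpoly_eval P (ind (U \<union> X)) \<noteq> 0"
    and K: "\<And>Y. card Y \<in> K \<Longrightarrow> mpoly_eval P (ind Y) = 0"
  shows "card (K \<inter> {card U..card U + card Z}) \<le> mpoly_degree P"
proof (rule ccontr)
  assume "\<not> ?thesis"
  then have less: "mpoly_degree P < card (K \<inter> {card U..card U + card Z})" by simp
  define w where "w = card U + card X"
  \<comment> \<open>The layers of the subcube where \<open>P\<close> is not known to vanish, without
    the layer of the distinguished vertex.\<close>
  define W where "W = {card U..card U + card Z} - K - {w}"
  define R :: "'n mpoly" where "R = (\<Prod>w\<in>W. affine_form 1 (real w))"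
  have cU: "card (U \<union> C) = card U + card C" if "C \<subseteq> Z" for C
    using that assms(1) by (intro card_Un_disjoint) auto
  have "w \<notin> K" using nz K[of "U \<union> X"] cU[OF \<open>X \<subseteq> Z\<close>] by (auto simp: w_def)
  moreover have "w \<in> {card U..card U + card Z}"
    using \<open>X \<subseteq> Z\<close> by (simp add: w_def card_mono)
  ultimately have "{card U..card U + card Z} = insert w ((K \<inter> {card U..card U + card Z}) \<union> W)"
    by (auto simp: W_def)
  moreover have "w \<notin> (K \<inter> {card U..card U + card Z}) \<union> W" using \<open>w \<notin> K\<close> by (auto simp: W_def)
  moreover have "card ((K \<inter> {card U..card U + card Z}) \<union> W) = card (K \<inter> {card U..card U + card Z}) + card W"
    by (intro card_Un_disjoint) (auto simp: W_def)
  moreover have "finite W" by (simp add: W_def)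
  \<comment> \<open>The \<open>card Z + 1\<close> weights of the subcube split into
    \<open>w\<close>, those in \<open>K\<close> and those in \<open>W\<close>; this balances the
    degree of \<open>R\<close> against the assumed bound on \<open>P\<close>.\<close>
  ultimately have "Suc (card Z) = Suc (card (K \<inter> {card U..card U + card Z}) + card W)"
    by (metis (no_types, lifting) card_insert_disjoint card_atLeastAtMost add_diff_cancel_left'
        add_Suc_right finite_Int finite_Un finite_atLeastAtMost)
  moreover have "mpoly_degree R \<le> card W"
    using degree_prod_mset_le[of "mset_set W" "\<lambda>w. affine_form 1 (real w) :: 'n mpoly"]
    by (simp add: R_def degree_affine_form prod_unfold_prod_mset)
  ultimately have "mpoly_degree (R * P) < card Z"
    using less degree_mult[of R P] by simp
  then have "(\<Sum>C\<in>Pow Z. (-1) ^ card C * mpoly_eval (R * P) (ind (U \<union> C))) = 0"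
    by (rule alternating_sum_eq_0)
  \<comment> \<open>On a layer in \<open>K\<close> the factor \<open>P\<close> vanishes, on a layer
    in \<open>W\<close> a factor of \<open>R\<close>; only the term for \<open>X\<close>
    survives.\<close>
  moreover have "mpoly_eval (R * P) (ind (U \<union> C)) = 0" if "C \<subseteq> Z" "C \<noteq> X" for C
  proof (cases "card (U \<union> C) \<in> K")
    case False
    have "card C \<noteq> card X" using uniq that by blast
    moreover have "card C \<le> card Z" using that by (simp add: card_mono)
    ultimately have "card (U \<union> C) \<in> W"
      using False cU[OF that(1)] by (auto simp: W_def w_def)
    then show ?thesis
      using \<open>finite W\<close> by (auto simp: R_def eval_mult eval_prod hyperplane_weight prod_zero_iff)
  qed (simp add: K eval_mult)
  then have "(\<Sum>C\<in>Pow Z. (-1) ^ card C * mpoly_eval (R * P) (ind (U \<union> C))) =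
      (\<Sum>C\<in>{X}. (-1) ^ card C * mpoly_eval (R * P) (ind (U \<union> C)))"
    using \<open>X \<subseteq> Z\<close> by (intro sum.mono_neutral_right) auto
  moreover have "mpoly_eval R (ind (U \<union> X)) \<noteq> 0"
    using \<open>finite W\<close> cU[OF \<open>X \<subseteq> Z\<close>]
    by (auto simp: R_def eval_prod hyperplane_weight prod_zero_iff W_def w_def)
  ultimately show False using nz by (simp add: eval_mult)
qed

text \<open>The polynomial obtained is a coefficient \<open>G \<alpha>\<close> with |\<alpha>| = s;
  its factor Y^\<alpha> accounts for the degree \<open>2 * s\<close>.\<close>

lemma cover_leading_coefficient:
  fixes P :: "'n::finite mpoly"
  assumes cube: "\<And>a. a \<in> cube \<Longrightarrow> vanishes_to_order s P a"
    and T: "T \<subseteq> cube" "\<And>a. a \<in> T \<Longrightarrow> vanishes_to_order (Suc s) P a"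
    and p: "p \<in> cube" "\<not> vanishes_to_order (Suc s) P p"
  obtains G where "mpoly_degree G + 2 * s \<le> mpoly_degree P" "mpoly_eval G p \<noteq> 0"
    "\<And>a. a \<in> T \<Longrightarrow> mpoly_eval G a = 0"
proof -
  define A where "A = {\<alpha> :: 'n \<Rightarrow> nat. 2 * sum \<alpha> UNIV \<le> mpoly_degree P}"
  obtain G where P: "P = (\<Sum>\<alpha>\<in>A. vanisher_power \<alpha> * G \<alpha>)"
    and G: "\<And>\<alpha>. multilinear (G \<alpha>)" "\<And>\<alpha>. mpoly_degree (G \<alpha>) \<le> mpoly_degree P - 2 * sum \<alpha> UNIV"
    using expandable[of P] unfolding expandable_def A_def by blast
  have "finite A" unfolding A_def by (rule finite_bounded_exponents)
  \<comment> \<open>Strong induction on |\<alpha>|: once all lower coefficients are 0, the criterion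
    at order |\<alpha>| makes \<open>G \<alpha>\<close> vanish on the whole cube, and a multilinear
    polynomial doing so is 0.\<close>
  have low: "G \<alpha> = 0" if "\<alpha> \<in> A" "sum \<alpha> UNIV < s" for \<alpha>
    using that
  proof (induction "sum \<alpha> UNIV" arbitrary: \<alpha> rule: less_induct)
    case less
    show ?case
    proof (rule multilinear_eq_0[OF G(1)])
      fix X
      have "vanishes_to_order (Suc (sum \<alpha> UNIV)) P (ind X)"
        by (rule vanishes_mono[OF cube]) (use less.prems in auto)
      moreover have "G \<beta> = 0" if "\<beta> \<in> A" "sum \<beta> UNIV < sum \<alpha> UNIV" for \<beta>
        using less that by auto
      ultimately show "mpoly_eval (G \<alpha>) (ind X) = 0"
        using vanishes_expansion_iff[OF \<open>finite A\<close> P, of "sum \<alpha> UNIV" "ind X"] less.prems by auto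
    qed
  qed
  note iff = vanishes_expansion_iff[OF \<open>finite A\<close> P low, of s]
  obtain \<alpha> where \<alpha>: "\<alpha> \<in> A" "sum \<alpha> UNIV = s" "mpoly_eval (G \<alpha>) p \<noteq> 0"
    using p iff[of p] by auto
  show thesis
  proof
    show "mpoly_degree (G \<alpha>) + 2 * s \<le> mpoly_degree P"
      using \<alpha> G(2)[of \<alpha>] by (simp add: A_def)
    show "mpoly_eval (G \<alpha>) a = 0" if "a \<in> T" for a
      using that T \<alpha> iff[of a] by auto
  qed (rule \<alpha>)
qed

section \<open>Multiplicities of products of affine forms\<close>

lemma vanishes_prod_mset:
  "(\<And>i. i \<in># M \<Longrightarrow> mpoly_eval (F i) a = 0) \<Longrightarrow>
   vanishes_to_order (size M) (\<Prod>\<^sub># (image_mset F M)) a"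
proof (induction M)
  case (add i M)
  then have "vanishes_to_order 1 (F i) a" "vanishes_to_order (size M) (\<Prod>\<^sub># (image_mset F M)) a"
    by (simp_all add: vanishes_1)
  from vanishes_mult[OF this] show ?case by (simp add: One_nat_def)
qed simp

text \<open>Factors vanishing at \<open>x\<close> contribute at least one order each. They
  contribute no more: along a line through \<open>x\<close> parallel to none of the hyperplanes each
  of them is a nonzero multiple of \<open>s\<close>, while the other factors stay nonzero at
  \<open>x\<close>.\<close>

lemma mult_prod_affine_forms:
  fixes c :: "'b \<Rightarrow> real^'n::finite"
  assumes c: "\<And>i. i \<in># M \<Longrightarrow> c i \<noteq> 0"
  shows "mpoly_mult (\<Prod>\<^sub># (image_mset (\<lambda>i. affine_form (c i) (b i)) M)) x
    = enat (size {#i \<in># M. c i \<bullet> x = b i#})"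
proof -
  define M1 where "M1 = {#i \<in># M. c i \<bullet> x = b i#}"
  define M2 where "M2 = {#i \<in># M. \<not> c i \<bullet> x = b i#}"
  define P where "P = (\<lambda>M. \<Prod>\<^sub># (image_mset (\<lambda>i. affine_form (c i) (b i)) M))"
  have "M = M1 + M2" unfolding M1_def M2_def by (rule multiset_partition)
  then have PM: "P M = P M1 * P M2" by (simp add: P_def)
  have "vanishes_to_order (size M1) (P M1) x"
    unfolding P_def by (rule vanishes_prod_mset) (auto simp: M1_def)
  from vanishes_mult[OF this vanishes_0[of "P M2"]]
  have "vanishes_to_order (size M1) (P M) x" by (simp add: PM)
  moreover have "\<not> vanishes_to_order (Suc (size M1)) (P M) x"
  proof
    assume *: "vanishes_to_order (Suc (size M1)) (P M) x"
    have "0 \<notin> c ` set_mset M" using c by auto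
    then obtain v where "\<And>a. a \<in> c ` set_mset M \<Longrightarrow> a \<bullet> v \<noteq> 0"
      using generic_direction[of "c ` set_mset M"] by (metis finite_imageI finite_set_mset)
    then have v: "\<And>i. i \<in># M \<Longrightarrow> c i \<bullet> v \<noteq> 0" by auto
    define q where "q = (\<Prod>i\<in>#M1. c i \<bullet> v)"
    have line: "mpoly_eval (P M1) (x + s *\<^sub>R v) = s ^ size M1 * q" for s
    proof -
      have "mpoly_eval (P N) (x + s *\<^sub>R v) = s ^ size N * (\<Prod>i\<in>#N. c i \<bullet> v)"
        if "\<forall>i\<in>#N. c i \<bullet> x = b i" for N
        using that by (induction N) (auto simp: P_def eval_mult inner_add_right)
      then show ?thesis by (simp add: q_def M1_def)
    qed
    have "\<forall>\<^sub>F s in at (0::real). mpoly_eval (P M) (x + s *\<^sub>R v) / s ^ size M1 = q * mpoly_eval (P M2) (x + s *\<^sub>R v)"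
      by (rule eventually_mono[OF eventually_neq_at_within[of 0]]) (simp add: PM eval_mult line)
    from Lim_transform_eventually[OF vanishes_imp_tendsto[OF *] this]
    have "((\<lambda>s. q * mpoly_eval (P M2) (x + s *\<^sub>R v)) \<longlongrightarrow> 0) (at (0::real))" .
    moreover have "((\<lambda>s. q * mpoly_eval (P M2) (x + s *\<^sub>R v)) \<longlongrightarrow> q * mpoly_eval (P M2) x) (at (0::real))"
      by (intro tendsto_intros tendsto_eval_line)
    ultimately have "q * mpoly_eval (P M2) x = 0" by (metis LIM_unique)
    moreover have "q \<noteq> 0" using v by (auto simp: q_def M1_def)
    moreover have "mpoly_eval (P M2) x \<noteq> 0"
      by (auto simp: P_def eval_prod_mset M2_def)
    ultimately show False by simp
  qed
  ultimately show ?thesis unfolding mult_eq_iff P_def M1_def by blast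
qed

subsection \<open>Covers\<close>

lemma polynomial_cover_of_hyperplane_cover:
  fixes T :: "(real^'n::finite) set"
  assumes "exact_hyperplane_cover t l T \<H>"
  obtains P where "exact_polynomial_cover t l T P" "mpoly_degree P \<le> size \<H>"
proof -
  have "\<forall>H. \<exists>a b. H \<in># \<H> \<longrightarrow> a \<noteq> (0::real^'n) \<and> H = {x. a \<bullet> x = b}"
    using assms unfolding exact_hyperplane_cover_def affine_hyperplane_def by blast
  \<comment> \<open>The form depends only on the hyperplane as a set, so repeated members of the
    cover repeat the same factor.\<close>
  then obtain c b where cb: "\<And>H. H \<in># \<H> \<Longrightarrow> c H \<noteq> (0::real^'n) \<and> H = {x. c H \<bullet> x = b H}"
    by metis
  define P where "P = (\<Prod>\<^sub># (image_mset (\<lambda>H. affine_form (c H) (b H)) \<H>))"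
  have mult: "mpoly_mult P x = enat (size {#H \<in># \<H>. x \<in> H#})" for x
  proof -
    have "{#H \<in># \<H>. c H \<bullet> x = b H#} = {#H \<in># \<H>. x \<in> H#}"
      using cb by (intro filter_mset_cong) auto
    then show ?thesis unfolding P_def using mult_prod_affine_forms[of \<H> c b x] cb by simp
  qed
  show thesis
  proof
    \<comment> \<open>The zero polynomial vanishes to every order, whereas \<open>P\<close> has
      finite multiplicity at the origin.\<close>
    have "P \<noteq> 0" using mult[of 0] vanishes_zero by (metis mult_eq_iff)
    then show "exact_polynomial_cover t l T P"
      using assms by (simp add: exact_polynomial_cover_def exact_hyperplane_cover_def mult)
    show "mpoly_degree P \<le> size \<H>"
      unfolding P_def by (rule degree_prod_mset_le) (rule degree_affine_form)
  qed
qed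

text \<open>The \<open>k\<close>-th hyperplane (\<open>k = 0, ..., m - 1\<close>, coordinates numbered from \<open>0\<close>) is
  \<open>(\<Sum>j>k. x\<^sub>j) = (m - 1 - k) + (n + k + 1 - 2 m) x\<^sub>k\<close>. For \<open>k = 0\<close> it meets the cube in the points
  of weight \<open>m - 1\<close> with \<open>x\<^sub>0 = 0\<close> and of weight \<open>n - m + 1\<close> with \<open>x\<^sub>0 = 1\<close>; the other hyperplanes
  solve the problem with \<open>n - 1\<close> and \<open>m - 1\<close> on the remaining coordinates.\<close>

lemma peripheral_cover:
  fixes m :: nat
  assumes "m < CARD('n::finite)"
  obtains \<H> :: "(real^'n) set multiset"
  where "\<And>H. H \<in># \<H> \<Longrightarrow> affine_hyperplane H" "size \<H> = m"
    "\<And>X. (\<exists>H\<in>#\<H>. ind X \<in> H) \<longleftrightarrow> card X < m \<or> CARD('n) - m < card X"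
proof -
  let ?n = "CARD('n)"
  obtain e where e: "bij_betw e (UNIV :: 'n set) {0..<?n}"
    using ex_bij_betw_finite_nat[of "UNIV :: 'n set"] by auto
  define c :: "nat \<Rightarrow> real^'n" where "c = (\<lambda>k. \<chi> i. if k < e i then 1 else
      if k = e i then 2 * real m - real ?n - real k - 1 else 0)"
  define H where "H = (\<lambda>k. {x. c k \<bullet> x = real m - 1 - real k})"
  \<comment> \<open>The weight left on the coordinates numbered from \<open>k\<close> on, that is,
    the weight in the subproblem after \<open>k\<close> reductions.\<close>
  define tail where "tail = (\<lambda>X k. card {i \<in> X. k \<le> e i})"
  have tail_Suc: "tail X k = (if inv e k \<in> X then 1 else 0) + tail X (Suc k)"
    and mem_H: "ind X \<in> H k \<longleftrightarrow> real (tail X (Suc k)) = real m - 1 - real k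
      + (if inv e k \<in> X then real ?n + real k + 1 - 2 * real m else 0)" if "k < ?n" for X k
  proof -
    have eq: "k = e i \<longleftrightarrow> i = inv e k" for i
      using e that by (metis UNIV_I atLeastLessThan_iff bij_betw_imp_inj_on bij_betw_imp_surj_on
          f_inv_into_f inv_f_f le0)
    have le: "k \<le> e i \<longleftrightarrow> i = inv e k \<or> Suc k \<le> e i" for i
      unfolding eq[symmetric] by auto
    have inv: "e (inv e k) = k" using eq by metis
    have "{i \<in> X. k \<le> e i} = {i \<in> X. i = inv e k} \<union> {i \<in> X. Suc k \<le> e i}"
      by (auto simp: le)
    moreover have "{i \<in> X. i = inv e k} \<inter> {i \<in> X. Suc k \<le> e i} = {}" using inv by auto
    moreover have "{i \<in> X. i = inv e k} = (if inv e k \<in> X then {inv e k} else {})" by auto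
    ultimately show "tail X k = (if inv e k \<in> X then 1 else 0) + tail X (Suc k)"
      by (simp add: tail_def card_Un_disjoint)
    have "c k \<bullet> ind X = (\<Sum>i\<in>UNIV. (if i \<in> X \<and> k < e i then 1 else 0) +
        (if i = inv e k then if inv e k \<in> X then 2 * real m - real ?n - real k - 1 else 0 else 0))"
      unfolding inner_vec_def by (rule sum.cong) (auto simp: c_def ind_def eq inv)
    also have "\<dots> = real (tail X (Suc k)) +
        (if inv e k \<in> X then 2 * real m - real ?n - real k - 1 else 0)"
      using sum.inter_filter[of UNIV "\<lambda>_. 1 :: real" "\<lambda>i. i \<in> X \<and> k < e i"]
      by (simp add: sum.distrib tail_def Suc_le_eq)
    finally show "ind X \<in> H k \<longleftrightarrow> real (tail X (Suc k)) = real m - 1 - real k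
      + (if inv e k \<in> X then real ?n + real k + 1 - 2 * real m else 0)"
      by (auto simp: H_def)
  qed
  \<comment> \<open>Downward induction from \<open>k = m\<close>. The subproblem has n - k
    coordinates and m - k hyperplanes, so its upper threshold (n - k) - (m - k) is always n -
    m.\<close>
  have cover: "(\<exists>k'\<in>{k..<m}. ind X \<in> H k') \<longleftrightarrow> tail X k < m - k \<or> ?n - m < tail X k"
    if "k \<le> m" for X k
    using that
  proof (induction k rule: inc_induct)
    case base
    \<comment> \<open>With no hyperplane left, the remaining n - m coordinates cannot carry a weight
      above n - m.\<close>
    have "e ` {i \<in> X. m \<le> e i} \<subseteq> {m..<?n}" using e by (auto simp: bij_betw_def)
    moreover have "inj_on e {i \<in> X. m \<le> e i}"
      using e by (auto simp: bij_betw_def intro: inj_on_subset)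
    ultimately have "tail X m \<le> ?n - m"
      unfolding tail_def using card_inj_on_le[of e _ "{m..<?n}"] by simp
    then show ?case by simp
  next
    case (step k)
    have "{k..<m} = insert k {Suc k..<m}" using step.hyps by auto
    then have "(\<exists>k'\<in>{k..<m}. ind X \<in> H k') \<longleftrightarrow>
        ind X \<in> H k \<or> tail X (Suc k) < m - Suc k \<or> ?n - m < tail X (Suc k)"
      using step.IH by simp
    also have "ind X \<in> H k \<longleftrightarrow> tail X (Suc k) = (if inv e k \<in> X then ?n - m else m - Suc k)"
      using mem_H[of k X] step.hyps assms by (auto simp: of_nat_diff)
    finally show ?case
      using tail_Suc[of k X] step.hyps assms by (auto split: if_splits)
  qed
  have affine: "affine_hyperplane (H k)" if "k < m" for k
  proof -
    \<comment> \<open>The coefficient at coordinate \<open>k\<close> may be 0, but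
      \<open>m < n\<close> guarantees a next coordinate, where the coefficient is 1.\<close>
    have "Suc k \<in> range e" using e that assms by (auto simp: bij_betw_def)
    then obtain i where "e i = Suc k" by (metis imageE)
    then have "c k $ i \<noteq> 0" by (simp add: c_def)
    then have "c k \<noteq> 0" by auto
    then show ?thesis unfolding affine_hyperplane_def H_def by blast
  qed
  show thesis
  proof (rule that[of "image_mset H (mset_set {0..<m})"])
    fix X
    show "(\<exists>H'\<in>#image_mset H (mset_set {0..<m}). ind X \<in> H') \<longleftrightarrow> card X < m \<or> CARD('n) - m < card X"
      using cover[of 0 X] by (simp add: tail_def)
  qed (use affine in auto)
qed

section \<open>Weights of symmetric sets and of their complements\<close>

lemma permute_ind:
  assumes "symmetric_set S" "ind X \<in> S" "card X = card (Y :: 'n::finite set)"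
  shows "ind Y \<in> S"
proof -
  obtain f where f: "bij_betw f Y X" using assms(3) by (metis finite finite_same_card_bij)
  have "card (- X) = card (- Y)" using assms(3) by (simp add: Compl_eq_Diff_UNIV card_Diff_subset)
  then obtain g where g: "bij_betw g (- Y) (- X)" by (metis finite finite_same_card_bij)
  \<comment> \<open>Bijections between the supports and between their complements glue to a
    coordinate permutation carrying one point to the other.\<close>
  define h where "h = (\<lambda>i. if i \<in> Y then f i else g i)"
  have "bij_betw h Y X" using f bij_betw_cong[of Y h f X] by (simp add: h_def)
  moreover have "bij_betw h (- Y) (- X)"
    using g bij_betw_cong[of "- Y" h g "- X"] by (simp add: h_def)
  ultimately have "bij h" and hX: "h i \<in> X \<longleftrightarrow> i \<in> Y" for i
    using bij_betw_combine[of h Y X "- Y" "- X"] by (auto simp: bij_betw_def)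
  then have "(\<chi> i. ind X $ h i) \<in> S" using assms by (auto simp: symmetric_set_def)
  moreover have "(\<chi> i. ind X $ h i) = ind Y" by (simp add: ind_def hX vec_eq_iff)
  ultimately show ?thesis by simp
qed

text \<open>A symmetric set is a union of full layers of the cube, so each weight belongs either to
  it or to its complement, never to both.\<close>

lemma weight_set_iff:
  assumes "symmetric_set S"
  shows "card X \<in> weight_set (cube - S) \<longleftrightarrow> ind X \<notin> S"
proof
  assume "card X \<in> weight_set (cube - S)"
  then obtain Y where "card X = card Y" "ind Y \<notin> S"
    by (auto simp: weight_set_def elim!: cubeE)
  then show "ind X \<notin> S" using permute_ind[OF assms] by metis
next
  assume "ind X \<notin> S"
  then have "hamming_weight (ind X) \<in> weight_set (cube - S)"
    unfolding weight_set_def by (intro imageI) simp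
  then show "card X \<in> weight_set (cube - S)" by simp
qed

lemma weight_set_bounded: "weight_set (T :: (real^'n::finite) set) \<subseteq> {..CARD('n)}"
  by (auto simp: weight_set_def hamming_weight_def intro: card_mono)

text \<open>A missed weight \<open>w\<close> lies between \<open>mu T\<close> and
  \<open>n - mu T\<close>, which sharpens the rounded bound in \<open>mu\<close> to
  \<open>2 * mu T \<le> n\<close>. Passing to the next peripheral interval adds only these two
  weights, so maximality shows that one of them is missed.\<close>

lemma mu_properties:
  fixes T :: "(real^'n::finite) set"
  assumes "w \<le> CARD('n)" "w \<notin> weight_set T"
  shows "peripheral_interval CARD('n) (mu T) \<subseteq> weight_set T" "2 * mu T \<le> CARD('n)"
    "mu T \<notin> weight_set T \<or> CARD('n) - mu T \<notin> weight_set T"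
proof -
  let ?n = "CARD('n)"
  let ?A = "{i. i \<le> nat \<lceil>real ?n / 2\<rceil> \<and> peripheral_interval ?n i \<subseteq> weight_set T}"
  have le_iff: "i \<le> nat \<lceil>real ?n / 2\<rceil> \<longleftrightarrow> 2 * i \<le> ?n + 1" for i
    by linarith
  have fin: "finite ?A" by simp
  have "0 \<in> ?A" by (simp add: peripheral_interval_def)
  then have "mu T \<in> ?A" unfolding mu_def using Max_in[OF fin] by blast
  then show per: "peripheral_interval ?n (mu T) \<subseteq> weight_set T" by simp
  have le: "2 * mu T \<le> ?n + 1" using \<open>mu T \<in> ?A\<close> le_iff by simp
  have "w \<notin> peripheral_interval ?n (mu T)" using per assms by blast
  then have w: "mu T \<le> w" "w \<le> ?n - mu T"
    using assms(1) by (auto simp: peripheral_interval_def)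
  then show le': "2 * mu T \<le> ?n" using le by linarith
  \<comment> \<open>If \<open>2 * mu T = n\<close>, the next index exceeds the allowed range and
    maximality says nothing; then \<open>w\<close> itself is the middle weight.\<close>
  show "mu T \<notin> weight_set T \<or> ?n - mu T \<notin> weight_set T"
  proof (cases "2 * mu T = ?n")
    case True
    then have "w = mu T" using w by linarith
    then show ?thesis using assms by simp
  next
    case False
    have "Suc (mu T) \<notin> ?A"
    proof
      assume "Suc (mu T) \<in> ?A"
      then have "Suc (mu T) \<le> mu T" unfolding mu_def by (rule Max_ge[OF fin])
      then show False by simp
    qed
    then have "\<not> peripheral_interval ?n (Suc (mu T)) \<subseteq> weight_set T"
      using False le' le_iff by auto
    moreover have "peripheral_interval ?n (Suc (mu T)) \<subseteq> insert (mu T) (insert (?n - mu T) (peripheral_interval ?n (mu T)))"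
      using False le' by (auto simp: peripheral_interval_def)
    ultimately show ?thesis using per by blast
  qed
qed

lemma card_peripheral_interval:
  "2 * i \<le> n \<Longrightarrow> card (peripheral_interval n i) = 2 * i"
  unfolding peripheral_interval_def by (subst card_Un_disjoint) auto

section \<open>Lower and upper bounds for covers\<close>

lemma polynomial_cover_lower_bound:
  fixes S :: "(real^'n::finite) set"
  assumes S: "S \<subseteq> cube" "S \<noteq> {}" "symmetric_set S"
    and P: "exact_polynomial_cover (Suc s) s (cube - S) P"
  shows "Lambda_bar S + 2 * s \<le> mpoly_degree P"
proof -
  let ?n = "CARD('n)"
  define K where "K = weight_set (cube - S)"
  define m where "m = mu (cube - S)"
  have iff: "card X \<in> K \<longleftrightarrow> ind X \<notin> S" for X
    unfolding K_def by (rule weight_set_iff[OF S(3)])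
  obtain X1 where X1: "ind X1 \<in> S" using S(1,2) by (metis cubeE ex_in_conv subset_iff)
  have "card X1 \<le> ?n" by (simp add: card_mono)
  then have m: "2 * m \<le> ?n" "m \<notin> K \<or> ?n - m \<notin> K"
    using mu_properties(2,3)[of "card X1" "cube - S"] iff[of X1] X1 by (auto simp: K_def m_def)
  have Kn: "K \<subseteq> {..?n}" unfolding K_def by (rule weight_set_bounded)
  have PS: "vanishes_to_order s P a" "\<not> vanishes_to_order (Suc s) P a" if "a \<in> S" for a
    using P that S(1) by (auto simp: exact_polynomial_cover_def mult_eq_iff)
  have PT: "vanishes_to_order (Suc s) P a" if "a \<in> cube - S" for a
    using P that by (auto simp: exact_polynomial_cover_def enat_le_mult_iff)
  have cube: "vanishes_to_order s P a" if "a \<in> cube" for a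
    using PS(1) PT that vanishes_mono[of "Suc s" P a s] by fastforce
  have *: "card (K \<inter> {card U..card U + card Z}) + 2 * s \<le> mpoly_degree P"
    if "U \<inter> Z = {}" "X \<subseteq> Z" "\<And>C. C \<subseteq> Z \<Longrightarrow> card C = card X \<Longrightarrow> C = X" "card (U \<union> X) \<notin> K" for U Z X :: "'n set"
  proof -
    have "ind (U \<union> X) \<in> S" using that(4) iff by blast
    then have nv: "\<not> vanishes_to_order (Suc s) P (ind (U \<union> X))" by (rule PS(2))
    obtain G where G: "mpoly_degree G + 2 * s \<le> mpoly_degree P" "mpoly_eval G (ind (U \<union> X)) \<noteq> 0"
      "\<And>a. a \<in> cube - S \<Longrightarrow> mpoly_eval G a = 0"
      by (rule cover_leading_coefficient[of s P "cube - S" "ind (U \<union> X)"])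
         (erule cube | erule PT | rule nv ind_in_cube Diff_subset | rule that; assumption)+
    have "card (K \<inter> {card U..card U + card Z}) \<le> mpoly_degree G"
      by (rule subcube_degree[OF that(1-3) G(2)]) (use G(3) iff in auto)
    then show ?thesis using G(1) by simp
  qed
  from m(2) have "card K - m + 2 * s \<le> mpoly_degree P"
  proof
    \<comment> \<open>The missed point is the bottom of the subcube above \<open>U\<close>. Only the
      \<open>m\<close> layers below it escape the count.\<close>
    assume "m \<notin> K"
    obtain U :: "'n set" where U: "card U = m"
      using obtain_subset_with_card_n[of m "UNIV :: 'n set"] m(1) by auto
    have cZ: "card (- U) = ?n - m" using U by (simp add: Compl_eq_Diff_UNIV card_Diff_subset)
    have "card K \<le> card ({..<m} \<union> K \<inter> {m..?n})"
      using Kn by (intro card_mono) auto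
    also have "\<dots> \<le> m + card (K \<inter> {m..?n})" using card_Un_le[of "{..<m}"] by simp
    finally show ?thesis
      using *[of U "- U" "{}"] U cZ \<open>m \<notin> K\<close> m(1) by simp
  next
    \<comment> \<open>Dually, the missed point is the top of the subcube of subsets of
      \<open>Z\<close>, and the \<open>m\<close> layers above it escape.\<close>
    assume nm: "?n - m \<notin> K"
    obtain Z :: "'n set" where Z: "card Z = ?n - m"
      using obtain_subset_with_card_n[of "?n - m" "UNIV :: 'n set"] by auto
    have "card K \<le> card ({?n - m<..?n} \<union> K \<inter> {0..?n - m})"
      using Kn by (intro card_mono) auto
    also have "\<dots> \<le> m + card (K \<inter> {0..?n - m})"
      using card_Un_le[of "{?n - m<..?n}" "K \<inter> {0..?n - m}"] m(1) by simp
    finally show ?thesis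
      using *[of "{}" Z Z] Z nm by (simp add: card_subset_eq)
  qed
  then show ?thesis by (simp add: Lambda_bar_def Lambda_def K_def m_def)
qed

lemma hyperplane_cover_upper_bound:
  fixes S :: "(real^'n::finite) set"
  assumes S: "S \<subseteq> cube" "S \<noteq> {}" "symmetric_set S"
  obtains \<H> where "exact_hyperplane_cover (Suc s) s (cube - S) \<H>" "size \<H> = Lambda_bar S + 2 * s"
proof -
  let ?n = "CARD('n)"
  define K where "K = weight_set (cube - S)"
  define m where "m = mu (cube - S)"
  have iff: "card X \<in> K \<longleftrightarrow> ind X \<notin> S" for X
    unfolding K_def by (rule weight_set_iff[OF S(3)])
  obtain X1 where X1: "ind X1 \<in> S" using S(1,2) by (metis cubeE ex_in_conv subset_iff)
  have "card X1 \<le> ?n" by (simp add: card_mono)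
  then have m: "2 * m \<le> ?n" and per: "peripheral_interval ?n m \<subseteq> K"
    using mu_properties(1,2)[of "card X1" "cube - S"] iff[of X1] X1 by (auto simp: K_def m_def)
  have Kn: "K \<subseteq> {..?n}" unfolding K_def by (rule weight_set_bounded)
  have "finite K" using Kn finite_subset by blast
  have "0 < ?n" by simp
  then have "m < ?n" using m by linarith
  then obtain \<P> :: "(real^'n) set multiset"
    where \<P>: "\<And>H. H \<in># \<P> \<Longrightarrow> affine_hyperplane H" "size \<P> = m"
    "\<And>X. (\<exists>H\<in>#\<P>. ind X \<in> H) \<longleftrightarrow> card X < m \<or> ?n - m < card X"
    using peripheral_cover by blast
  define layer :: "nat \<Rightarrow> (real^'n) set" where "layer = (\<lambda>w. {x. 1 \<bullet> x = real w})"
  \<comment> \<open>The part that separates the complement from \<open>S\<close>: it meets the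
    former at every point and avoids the latter.\<close>
  define \<Q> where "\<Q> = \<P> + image_mset layer (mset_set (K - peripheral_interval ?n m))"
  have \<Q>: "(\<exists>H\<in>#\<Q>. ind X \<in> H) \<longleftrightarrow> ind X \<notin> S" for X
  proof -
    have "card X \<le> ?n" by (simp add: card_mono)
    then have "card X \<in> peripheral_interval ?n m \<longleftrightarrow> card X < m \<or> ?n - m < card X"
      by (auto simp: peripheral_interval_def)
    moreover have "(\<exists>H\<in>#\<Q>. ind X \<in> H) \<longleftrightarrow>
        (\<exists>H\<in>#\<P>. ind X \<in> H) \<or> card X \<in> K - peripheral_interval ?n m"
      using \<open>finite K\<close> by (simp add: \<Q>_def layer_def hyperplane_weight bex_Un)
    ultimately show ?thesis using \<P>(3) iff[of X] per by auto
  qed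
  \<comment> \<open>An arbitrary coordinate. Each cube point lies on exactly one of
    \<open>half 0\<close> and \<open>half 1\<close>, so \<open>s\<close> copies of both add exactly
    \<open>s\<close> everywhere.\<close>
  define i where "i = (undefined :: 'n)"
  define half :: "real \<Rightarrow> (real^'n) set" where "half = (\<lambda>b. {x. axis i 1 \<bullet> x = b})"
  define \<H> where "\<H> = \<Q> + (replicate_mset s (half 0) + replicate_mset s (half 1))"
  have rep: "size {#H \<in># replicate_mset s A. x \<in> H#} = (if x \<in> A then s else 0)"
    for A and x :: "real^'n"
    by (induction s) auto
  have count: "size {#H \<in># \<H>. ind X \<in> H#} = size {#H \<in># \<Q>. ind X \<in> H#} + s" for X
    by (simp add: \<H>_def rep) (simp add: half_def inner_axis' ind_def)
  have size0: "size {#H \<in># \<Q>. ind X \<in> H#} = 0 \<longleftrightarrow> ind X \<in> S" for X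
    using \<Q>[of X] by auto
  show thesis
  proof
    have "affine_hyperplane (layer w)" for w
      unfolding affine_hyperplane_def layer_def by (rule exI[of _ 1], rule exI[of _ "real w"]) simp
    moreover have "affine_hyperplane (half b)" for b
      unfolding affine_hyperplane_def half_def 
      by (rule exI[of _ "axis i 1"], rule exI[of _ b]) (simp add: axis_eq_0_iff)
    ultimately have "\<forall>H\<in>#\<H>. affine_hyperplane H"
      using \<P>(1) by (auto simp: \<H>_def \<Q>_def)
    moreover have "Suc s \<le> size {#H \<in># \<H>. a \<in> H#}" if a: "a \<in> cube - S" for a
    proof -
      obtain X where X: "a = ind X" using a cubeE[of a] by blast
      then have "size {#H \<in># \<Q>. ind X \<in> H#} \<noteq> 0" using a unfolding X size0 by blast
      then show ?thesis unfolding X using count[of X] by linarith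
    qed
    moreover have "size {#H \<in># \<H>. b \<in> H#} = s" if b: "b \<in> cube - (cube - S)" for b
    proof -
      obtain X where X: "b = ind X" using b cubeE[of b] by blast
      then have "size {#H \<in># \<Q>. ind X \<in> H#} = 0" using b unfolding X size0 by blast
      then show ?thesis unfolding X using count[of X] by linarith
    qed
    ultimately show "exact_hyperplane_cover (Suc s) s (cube - S) \<H>"
      by (simp add: exact_hyperplane_cover_def)
    have "card (K - peripheral_interval ?n m) = card K - 2 * m"
      using card_peripheral_interval[OF m] per \<open>finite K\<close>
      by (metis card_Diff_subset finite_subset)
    \<comment> \<open>Ensures that the subtraction does not truncate: the size of \<Q> is m + (card
      K - 2 m) = card K - m.\<close>
    moreover have "2 * m \<le> card K"
      using card_peripheral_interval[OF m] card_mono[OF \<open>finite K\<close> per] by simp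
    ultimately show "size \<H> = Lambda_bar S + 2 * s"
      by (simp add: \<H>_def \<Q>_def \<P>(2) Lambda_bar_def Lambda_def flip: K_def m_def)
  qed
qed

theorem theorem1p20:
  fixes S :: "(real^'n::finite) set" and t :: nat
  assumes "S \<subseteq> cube" and "S \<noteq> {}" and "symmetric_set S" and "t \<ge> 1"
  shows "EHC t (t - 1) (cube - S) = EPC t (t - 1) (cube - S) \<and>
         EPC t (t - 1) (cube - S) = enat (Lambda_bar S + 2 * t - 2)"
proof -
  \<comment> \<open>Writing \<open>t = Suc s\<close> removes the truncating subtractions
    \<open>t - 1\<close> and \<open>2 * t - 2\<close>.\<close>
  obtain s where s: "t = Suc s" using assms(4) by (cases t) auto
  let ?N = "enat (Lambda_bar S + 2 * s)" and ?T = "cube - S"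
  obtain \<H> where \<H>: "exact_hyperplane_cover (Suc s) s ?T \<H>" "size \<H> = Lambda_bar S + 2 * s"
    using hyperplane_cover_upper_bound[OF assms(1-3)] by blast
  have "EHC (Suc s) s ?T \<le> ?N"
    unfolding EHC_def using \<H> by (intro Inf_lower) (auto intro!: exI[of _ \<H>])
  moreover have "EPC (Suc s) s ?T \<le> EHC (Suc s) s ?T"
    unfolding EHC_def
  proof (rule Inf_greatest)
    fix x assume "x \<in> {enat (size \<H>) |\<H>. exact_hyperplane_cover (Suc s) s ?T \<H>}"
    then obtain \<H> where x: "x = enat (size \<H>)" and "exact_hyperplane_cover (Suc s) s ?T \<H>" by blast
    then obtain P where "exact_polynomial_cover (Suc s) s ?T P" "mpoly_degree P \<le> size \<H>"
      using polynomial_cover_of_hyperplane_cover by blast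
    then show "EPC (Suc s) s ?T \<le> x"
      unfolding EPC_def x by (intro Inf_lower2[of "enat (mpoly_degree P)"]) auto
  qed
  moreover have "?N \<le> EPC (Suc s) s ?T"
    unfolding EPC_def using polynomial_cover_lower_bound[OF assms(1-3)]
    by (intro Inf_greatest) auto
  \<comment> \<open>The inequalities close a cycle from \<open>?N\<close> through \<open>EPC\<close>
    and \<open>EHC\<close> back to \<open>?N\<close>.\<close>
  ultimately have "EHC (Suc s) s ?T = ?N" "EPC (Suc s) s ?T = ?N"
    by (meson order.trans order_antisym)+
  then show ?thesis by (simp add: s)
qed

end
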